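(* Consider a generalized Wallach space with $a_1=a_2=a_3=a\in(0,1/2)$, and let $\Sigma$, $\Sigma R$, $\Lambda_k$, $I_k$ and the differential system be as defined in the context. The following assertions hold for all indices with $\{i,j,k\}=\{1,2,3\}$. (1) The set $\Sigma R$ of invariant Riemannian metrics which belong to $\Sigma$ and admit positive Ricci curvature is bounded in $\Sigma$ by space curves $r_1,r_2,r_3$ (that is, the topological boundary of $\Sigma R$ relative to $\Sigma$ is $r_1\cup r_2\cup r_3$), where $r_k\subset\Sigma\cap\Lambda_k$ and each $r_k$ consists of two regular connected components $r_{ki}$ and $r_{kj}$ parameterized respectively by $$r_{ki}:\quad x_k=t^{-1}\beta^{-2},\quad x_i=t\beta,\quad x_j=\beta$$ and $$r_{kj}:\quad x_k=t^{-1}\beta^{-2},\quad x_j=t\beta,\quad x_i=\beta,$$ where $\beta=\beta(t):=\left(t^4-a^{-1}t^3+t^2\right)^{-1/6}>0$ and $t\in(0,a]$. (2) Every pair of the curves $r_i$ and $r_j$ has a unique common point $P_{ij}$; it has coordinates $x_i=x_j=a^{1/3}$, $x_k=a^{-2/3}$ and belongs to the components $r_{ij}$ and $r_{ji}$. In addition, every invariant curve $I_k$ meets the components $r_{ij}$ of $r_i$ and $r_{ji}$ of $r_j$ exactly at the point $P_{ij}$, and approaches their other components $r_{ik}$ and $r_{jk}$ at infinity as close as we like, i.e. the distance from the point $x_i=x_j=p$, $x_k=p^{-2}$ of $I_k$ to $r_{ik}$, and to $r_{jk}$, tends to $0$ as $p\to+\infty$. (3) For every $a\in(0,1/2)$ all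 singular (equilibrium) points of the system lying on $\Sigma$ belong to $\Sigma R$. (4) For $a=1/6$, the Kähler metrics $x_k=x_i+x_j$ form in $\Sigma$ a curve $l_k:=\{x\in\Sigma:x_k=x_i+x_j\}$ which is a separatrix of a saddle of the system (considered on $\Sigma$), and $l_k$ can be defined by the parametric equations $$x_k=t^{-1}\phi^{-2},\quad x_i=t\phi,\quad x_j=\phi,\qquad \phi=\phi(t):=(t^2+t)^{-1/3},\quad t>0.$$
   Context: A generalized Wallach space is a homogeneous almost effective compact space $G/H$ ($G$ a compact semisimple connected Lie group, $H$ a closed subgroup) whose isotropy representation decomposes as $\mathfrak p=\mathfrak p_1\oplus\mathfrak p_2\oplus\mathfrak p_3$ into $\operatorname{Ad}(H)$-invariant irreducible modules with $[\mathfrak p_i,\mathfrak p_i]\subset\mathfrak h$ for $i=1,2,3$. Such a space has an associated triple of parameters $a_i=A/\dim\mathfrak p_i\in(0,1/2]$, with $A>0$ a constant of the space; here $a_1=a_2=a_3=a$, and all objects below depend on the space only through $a$. Invariant metrics are identified with triples $(x_1,x_2,x_3)\in(0,+\infty)^3$ via $(\cdot,\cdot)=\sum_i x_i\langle\cdot,\cdot\rangle|_{\mathfrak p_i}$, where $\langle\cdot,\cdot\rangle$ is the negative of the Killing form of $\mathfrak g$. For $\{i,j,k\}=\{1,2,3\}$ put $$\lambda_i:=x_jx_k+a\,(x_i^2-x_j^2-x_k^2).$$ The set $R$ of metrics of positive Ricci curvature is $R:=\{x\in(0,+\infty)^3:\lambda_1>0,\lambda_2>0,\lambda_3>0\}$.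 Let $\Lambda_i:=\{x\in(0,+\infty)^3:\lambda_i=0\}$, $\Sigma:=\{x\in(0,+\infty)^3:x_1x_2x_3=1\}$ and $\Sigma R:=\Sigma\cap R$. Only metrics of unit volume, $x_1x_2x_3=1$, are considered. The normalized Ricci flow reduces to the system $$\frac{dx_i}{dt}=f_i(x_1,x_2,x_3):=\frac{x_i}{x_j}+\frac{x_i}{x_k}+2a\left(\frac{x_j}{x_k}+\frac{x_k}{x_j}-2\frac{x_i^2}{x_jx_k}\right)-2,\qquad\{i,j,k\}=\{1,2,3\},$$ for which $\Sigma$ and the curves $I_k:=\{x\in\Sigma:x_i=x_j=p,\ x_k=p^{-2},\ p>0\}$ are invariant. Singular (equilibrium) points are the points with $f_1=f_2=f_3=0$. A separatrix of a saddle is an invariant curve through the saddle consisting of the saddle and of trajectories tending to it as time tends to $+\infty$ or to $-\infty$. Double-index convention: for distinct $p,q\in\{1,2,3\}$ with third index $s$, $r_{pq}$ is the curve $x_p=t^{-1}\beta^{-2}$, $x_q=t\beta$, $x_s=\beta$, $t\in(0,a]$. *)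

theory Defs
  imports "HOL-Analysis.Analysis"
begin

(* Invariant metrics are points of real^3.  The index type 3 is arithmetic modulo 3, so the
   two indices different from i are i + 1 and i + 2; lam and f are symmetric in them. *)

definition metrics :: "(real^3) set" where
  "metrics = {x. \<forall>i. x $ i > 0}"

definition lam :: "real \<Rightarrow> 3 \<Rightarrow> real^3 \<Rightarrow> real" where
  "lam a i x = (let j = i + 1; k = i + 2 in
     x $ j * x $ k + a * ((x $ i)\<^sup>2 - (x $ j)\<^sup>2 - (x $ k)\<^sup>2))"

definition ricci_pos :: "real \<Rightarrow> (real^3) set" where
  "ricci_pos a = {x \<in> metrics. lam a 1 x > 0 \<and> lam a 2 x > 0 \<and> lam a 3 x > 0}"

definition Lambda :: "real \<Rightarrow> 3 \<Rightarrow> (real^3) set" where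
  "Lambda a i = {x \<in> metrics. lam a i x = 0}"

definition unit_vol :: "(real^3) set" where
  "unit_vol = {x \<in> metrics. x $ 1 * x $ 2 * x $ 3 = 1}"

definition unit_ricci_pos :: "real \<Rightarrow> (real^3) set" where
  "unit_ricci_pos a = unit_vol \<inter> ricci_pos a"

definition f :: "real \<Rightarrow> real^3 \<Rightarrow> real^3" where
  "f a x = (\<chi> i. let j = i + 1; k = i + 2 in
     x $ i / x $ j + x $ i / x $ k
     + 2 * a * (x $ j / x $ k + x $ k / x $ j - 2 * (x $ i)\<^sup>2 / (x $ j * x $ k)) - 2)"

lemma index3_cases:
  fixes i j k :: 3
  assumes "{i, j, k} = UNIV"
  shows "j = i + 1 \<and> k = i + 2 \<or> j = i + 2 \<and> k = i + 1"
proof -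
  have "1 \<in> {i, j, k}" "2 \<in> {i, j, k}" "3 \<in> {i, j, k}"
    using assms by auto
  then show ?thesis
    using exhaust_3[of i] by auto
qed

lemma lam_eq:
  assumes "{i, j, k} = (UNIV :: 3 set)"
  shows "lam a i x = x $ j * x $ k + a * ((x $ i)\<^sup>2 - (x $ j)\<^sup>2 - (x $ k)\<^sup>2)"
  using index3_cases[OF assms] by (auto simp: lam_def Let_def algebra_simps)

lemma f_eq:
  assumes "{i, j, k} = (UNIV :: 3 set)"
  shows "f a x $ i = x $ i / x $ j + x $ i / x $ k
     + 2 * a * (x $ j / x $ k + x $ k / x $ j - 2 * (x $ i)\<^sup>2 / (x $ j * x $ k)) - 2"
  using index3_cases[OF assms] by (auto simp: f_def Let_def algebra_simps)

definition I_point :: "3 \<Rightarrow> real \<Rightarrow> real^3" where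
  "I_point k p = (\<chi> m. if m = k then 1 / p\<^sup>2 else p)"

definition I_curve :: "3 \<Rightarrow> (real^3) set" where
  "I_curve k = I_point k ` {0<..}"

definition beta :: "real \<Rightarrow> real \<Rightarrow> real" where
  "beta a t = (t ^ 4 - t ^ 3 / a + t\<^sup>2) powr (- 1 / 6)"

definition r_param :: "real \<Rightarrow> 3 \<Rightarrow> 3 \<Rightarrow> real \<Rightarrow> real^3" where
  "r_param a p q t = (\<chi> m. if m = p then 1 / (t * (beta a t)\<^sup>2)
                           else if m = q then t * beta a t
                           else beta a t)"

definition r_comp :: "real \<Rightarrow> 3 \<Rightarrow> 3 \<Rightarrow> (real^3) set" where
  "r_comp a p q = r_param a p q ` {0<..a}"

definition r_curve :: "real \<Rightarrow> 3 \<Rightarrow> (real^3) set" where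
  "r_curve a k = (\<Union>q\<in>-{k}. r_comp a k q)"

definition P_point :: "real \<Rightarrow> 3 \<Rightarrow> 3 \<Rightarrow> real^3" where
  "P_point a i j = (\<chi> m. if m = i \<or> m = j then a powr (1 / 3) else a powr (- 2 / 3))"

definition phi :: "real \<Rightarrow> real" where
  "phi t = (t\<^sup>2 + t) powr (- 1 / 3)"

definition l_curve :: "3 \<Rightarrow> (real^3) set" where
  "l_curve k = {x \<in> unit_vol. x $ k = x $ (k + 1) + x $ (k + 2)}"

lemma l_curve_eq:
  assumes "{i, j, k} = (UNIV :: 3 set)"
  shows "l_curve k = {x \<in> unit_vol. x $ k = x $ i + x $ j}"
proof -
  have "{k, i, j} = UNIV" using assms by auto
  from index3_cases[OF this] show ?thesis by (auto simp: l_curve_def add.commute)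
qed

definition l_param :: "3 \<Rightarrow> 3 \<Rightarrow> real \<Rightarrow> real^3" where
  "l_param k i t = (\<chi> m. if m = k then 1 / (t * (phi t)\<^sup>2)
                         else if m = i then t * phi t
                         else phi t)"

(* Continuously differentiable with nowhere vanishing velocity; at an endpoint belonging to S
   the derivative is one-sided. *)
definition regular_param :: "(real \<Rightarrow> real^3) \<Rightarrow> real set \<Rightarrow> bool" where
  "regular_param \<gamma> S \<longleftrightarrow>
     (\<exists>\<gamma>'. continuous_on S \<gamma>' \<and>
        (\<forall>t\<in>S. (\<gamma> has_vector_derivative \<gamma>' t) (at t within S) \<and> \<gamma>' t \<noteq> 0))"

definition regular_open_curve :: "(real^3) set \<Rightarrow> bool" where
  "regular_open_curve L \<longleftrightarrow>
     (\<exists>\<gamma> S. open S \<and> is_interval S \<and> S \<noteq> {} \<and> regular_param \<gamma> S \<and> inj_on \<gamma> S \<and> L = \<gamma> ` S)"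

definition solution :: "real \<Rightarrow> real set \<Rightarrow> (real \<Rightarrow> real^3) \<Rightarrow> bool" where
  "solution a J x \<longleftrightarrow> open J \<and> is_interval J \<and> J \<noteq> {} \<and>
     (\<forall>t\<in>J. x t \<in> metrics \<and> (x has_vector_derivative f a (x t)) (at t))"

definition maximal_solution :: "real \<Rightarrow> real set \<Rightarrow> (real \<Rightarrow> real^3) \<Rightarrow> bool" where
  "maximal_solution a J x \<longleftrightarrow> solution a J x \<and>
     (\<forall>J' y. solution a J' y \<and> J \<subseteq> J' \<and> (\<forall>t\<in>J. y t = x t) \<longrightarrow> J' = J)"

definition invariant_set :: "real \<Rightarrow> (real^3) set \<Rightarrow> bool" where
  "invariant_set a L \<longleftrightarrow>
     (\<forall>J x. solution a J x \<and> (\<exists>t\<in>J. x t \<in> L) \<longrightarrow> x ` J \<subseteq> L)"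

definition tends_in_time :: "real set \<Rightarrow> (real \<Rightarrow> real^3) \<Rightarrow> real^3 \<Rightarrow> bool" where
  "tends_in_time J x z \<longleftrightarrow>
     (\<exists>s. {s..} \<subseteq> J) \<and> (x \<longlongrightarrow> z) at_top \<or> (\<exists>s. {..s} \<subseteq> J) \<and> (x \<longlongrightarrow> z) at_bot"

definition equilibrium :: "real \<Rightarrow> real^3 \<Rightarrow> bool" where
  "equilibrium a x \<longleftrightarrow> x \<in> metrics \<and> f a x = 0"

(* Tangent plane of unit_vol at z: the kernel of the differential of x1 x2 x3, divided by
   x1 x2 x3 = 1. *)
definition tangent_unit_vol :: "real^3 \<Rightarrow> (real^3) set" where
  "tangent_unit_vol z = {v. (\<Sum>i\<in>UNIV. v $ i / z $ i) = 0}"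

(* Saddle of the two-dimensional system induced on unit_vol: the linearization on the tangent
   plane has a negative and a positive eigenvalue.  The transversal eigenvalue of the
   three-dimensional system, which is 0, plays no role. *)
definition saddle :: "real \<Rightarrow> real^3 \<Rightarrow> bool" where
  "saddle a z \<longleftrightarrow> z \<in> unit_vol \<and> equilibrium a z \<and>
     (\<exists>D. (f a has_derivative D) (at z) \<and>
       (\<exists>\<mu> v. \<mu> < 0 \<and> v \<in> tangent_unit_vol z \<and> v \<noteq> 0 \<and> D v = \<mu> *\<^sub>R v) \<and>
       (\<exists>\<nu> w. \<nu> > 0 \<and> w \<in> tangent_unit_vol z \<and> w \<noteq> 0 \<and> D w = \<nu> *\<^sub>R w))"

definition separatrix :: "real \<Rightarrow> real^3 \<Rightarrow> (real^3) set \<Rightarrow> bool" where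
  "separatrix a z L \<longleftrightarrow> saddle a z \<and> L \<subseteq> unit_vol \<and> regular_open_curve L \<and> invariant_set a L \<and> z \<in> L \<and>
     (\<forall>y \<in> L - {z}. \<exists>J x. maximal_solution a J x \<and> y \<in> x ` J \<and> tends_in_time J x z)"

end

theory Submission
  imports Defs "HOL-Real_Asymp.Real_Asymp"
begin

text \<open>
  Everything rests on a few identities between the polynomials \<open>\<lambda>\<^sub>i\<close> and the vector field.

  The boundary. On the cone \<open>\<lambda>\<^sub>p = 0\<close> the two other polynomials factor:
  \<open>\<lambda>\<^sub>q = x\<^sub>s (x\<^sub>p + x\<^sub>q - 2 a x\<^sub>s)\<close>, and symmetrically for \<open>\<lambda>\<^sub>s\<close>. Comparing \<open>x\<^sub>p\<^sup>2\<close> with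
  \<open>(2 a x\<^sub>s - x\<^sub>q)\<^sup>2\<close> shows that the part of the cone with \<open>x\<^sub>q < x\<^sub>s\<close> on which
  \<open>\<lambda>\<^sub>q \<ge> 0\<close> is given by \<open>x\<^sub>q \<le> a x\<^sub>s\<close>, with \<open>\<lambda>\<^sub>q = 0\<close> exactly at \<open>x\<^sub>q = a x\<^sub>s\<close>
  and \<open>\<lambda>\<^sub>s > 0\<close> throughout. Within \<open>\<lambda>\<^sub>p = 0\<close> and unit volume the ratio
  \<open>t = x\<^sub>q / x\<^sub>s\<close> determines the point, by the formula for \<open>\<beta>\<close>. So \<open>r\<^sub>p\<^sub>q\<close> is the set of
  unit-volume metrics with \<open>\<lambda>\<^sub>p = 0\<close> and \<open>x\<^sub>q \<le> a x\<^sub>s\<close> (lemma \<open>r_comp_iff\<close>), and \<open>r\<^sub>p\<close> is the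
  part of \<open>\<lambda>\<^sub>p = 0\<close> on which no \<open>\<lambda>\<close> is negative (lemma \<open>r_curve_iff\<close>). The frontier of the
  positivity region lies in the union of these sets by continuity; conversely, enlarging the
  coordinate \<open>x\<^sub>q\<close> of a point of \<open>r\<^sub>p\<^sub>q\<close> and rescaling to unit volume makes all three \<open>\<lambda>\<close>
  positive. The intersections and the two components can be read off from the implicit
  description; the asymptotics follow from comparing the point of \<open>I\<^sub>k\<close> with parameter \<open>p\<close> and
  the point of \<open>r\<^sub>i\<^sub>k\<close> with parameter \<open>1/p\<^sup>3\<close>.

  Equilibria. Since \<open>f\<^sub>i x\<^sub>j x\<^sub>k = \<lambda>\<^sub>j + \<lambda>\<^sub>k - 2 \<lambda>\<^sub>i\<close>, a metric is an equilibrium iff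
  \<open>\<lambda>\<^sub>1 = \<lambda>\<^sub>2 = \<lambda>\<^sub>3\<close>. The factorization
  \<open>\<lambda>\<^sub>i - \<lambda>\<^sub>j = (x\<^sub>i - x\<^sub>j) (2 a (x\<^sub>i + x\<^sub>j) - x\<^sub>k)\<close> forces two coordinates to agree, and the common
  value of the \<open>\<lambda>\<close> is then visibly positive.

  Kaehler metrics, \<open>a = 1/6\<close>. Along a solution of unit volume \<open>g = x\<^sub>k - x\<^sub>i - x\<^sub>j\<close> satisfies a
  homogeneous linear equation \<open>g' = c g\<close>, so \<open>l\<^sub>k\<close> is invariant. On \<open>l\<^sub>k\<close> the coordinate \<open>u = x\<^sub>k\<close>
  obeys the autonomous equation \<open>u' = (2/3) (u\<^sup>3 - 4)\<close>, which has an explicit primitive. Inverting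
  it gives solutions on half lines \<open>]-\<infinity>, T[\<close> that tend to the equilibrium \<open>u\<^sup>3 = 4\<close> in the
  past and blow up at \<open>T\<close>, so they are maximal; they sweep out both halves of \<open>l\<^sub>k\<close>. At the
  equilibrium the linearization has the eigenvectors \<open>e\<^sub>i - e\<^sub>j\<close> (along \<open>l\<^sub>k\<close>, unstable) and
  \<open>e\<^sub>i + e\<^sub>j - 4 e\<^sub>k\<close> (stable).
\<close>

section \<open>Coordinates indexed by 3\<close>

text \<open>
  Three indices that exhaust the index type are pairwise distinct. This is the form in which the
  condition \<open>{i, j, k} = {1, 2, 3}\<close> enters below; later lemmas are stated for such a triple, so
  that permuting the indices replaces symmetry arguments.
\<close>

lemma index3_distinct:
  assumes "{i, j, k} = (UNIV :: 3 set)"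
  shows "i \<noteq> j" "j \<noteq> i" "i \<noteq> k" "k \<noteq> i" "j \<noteq> k" "k \<noteq> j"
proof -
  have "card {i, j, k} = 3"
    by (simp add: assms)
  then show "i \<noteq> j" "j \<noteq> i" "i \<noteq> k" "k \<noteq> i" "j \<noteq> k" "k \<noteq> j"
    by (auto simp: card_insert_if split: if_splits)
qed

lemma index3_succ: "{p, p + 1, p + 2} = (UNIV :: 3 set)"
proof -
  have "m \<in> {p, p + 1, p + 2}" for m
    using exhaust_3[of p] exhaust_3[of m] by auto
  then show ?thesis by blast
qed

lemma all_index3:
  assumes "{i, j, k} = (UNIV :: 3 set)"
  shows "(\<forall>m. P m) \<longleftrightarrow> P i \<and> P j \<and> P k"
  using assms by (metis UNIV_I empty_iff insert_iff)

lemma vec3_eq: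
  fixes x y :: "real^3"
  assumes "{i, j, k} = (UNIV :: 3 set)"
  shows "x = y \<longleftrightarrow> x $ i = y $ i \<and> x $ j = y $ j \<and> x $ k = y $ k"
  unfolding vec_eq_iff by (rule all_index3[OF assms])

lemma sum_index3:
  fixes g :: "3 \<Rightarrow> real"
  assumes "{i, j, k} = (UNIV :: 3 set)"
  shows "(\<Sum>m\<in>UNIV. g m) = g i + g j + g k"
  unfolding assms[symmetric] using index3_distinct[OF assms] by simp

lemma metrics_iff:
  assumes "{i, j, k} = (UNIV :: 3 set)"
  shows "x \<in> metrics \<longleftrightarrow> x $ i > 0 \<and> x $ j > 0 \<and> x $ k > 0"
  unfolding metrics_def using all_index3[OF assms, of "\<lambda>m. x $ m > 0"] by simp

lemma unit_vol_iff:
  assumes "{i, j, k} = (UNIV :: 3 set)"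
  shows "x \<in> unit_vol \<longleftrightarrow> x $ i > 0 \<and> x $ j > 0 \<and> x $ k > 0 \<and> x $ i * x $ j * x $ k = 1"
proof -
  have "x $ i * x $ j * x $ k = prod (($) x) {i, j, k}"
    using index3_distinct[OF assms] by simp
  also have "\<dots> = x $ 1 * x $ 2 * x $ 3"
    unfolding assms UNIV_3 by simp
  finally show ?thesis
    unfolding unit_vol_def using metrics_iff[OF assms] by auto
qed

lemma unit_ricci_pos_iff:
  "x \<in> unit_ricci_pos a \<longleftrightarrow> x \<in> unit_vol \<and> (\<forall>m. lam a m x > 0)"
  by (auto simp: unit_ricci_pos_def ricci_pos_def unit_vol_def forall_3)

section \<open>Componentwise derivatives and real powers\<close>

lemma has_derivative_vecI:
  fixes F D :: "'a::real_normed_vector \<Rightarrow> real^'n"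
  assumes "\<And>m. ((\<lambda>x. F x $ m) has_derivative (\<lambda>v. D v $ m)) (at z within S)"
  shows "(F has_derivative D) (at z within S)"
  unfolding has_derivative_componentwise_within[of F D]
proof
  fix b :: "real^'n" assume "b \<in> Basis"
  then obtain m where "b = axis m 1"
    by (auto simp: Basis_vec_def)
  then show "((\<lambda>x. F x \<bullet> b) has_derivative (\<lambda>v. D v \<bullet> b)) (at z within S)"
    using assms[of m] by (simp add: inner_axis)
qed

lemma has_vector_derivative_vecI:
  fixes x :: "real \<Rightarrow> real^'n"
  assumes "\<And>m. ((\<lambda>t. x t $ m) has_real_derivative v $ m) (at t within S)"
  shows "(x has_vector_derivative v) (at t within S)"
  unfolding has_vector_derivative_def
  by (rule has_derivative_vecI)
     (use assms in \<open>simp add: has_field_derivative_def mult_commute_abs\<close>)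

lemma has_vector_derivative_nth:
  fixes x :: "real \<Rightarrow> real^'n"
  assumes "(x has_vector_derivative v) (at t within S)"
  shows "((\<lambda>t. x t $ m) has_real_derivative v $ m) (at t within S)"
  using bounded_linear.has_vector_derivative[OF bounded_linear_vec_nth assms]
  by (simp add: has_real_derivative_iff_has_vector_derivative)

lemma has_real_derivative_powr_within:
  fixes g :: "real \<Rightarrow> real"
  assumes "(g has_real_derivative g') (at t within S)" "g t > 0"
  shows "((\<lambda>t. g t powr r) has_real_derivative r * g t powr (r - 1) * g') (at t within S)"
  using DERIV_chain2[OF has_real_derivative_powr[OF assms(2)] assms(1)] by simp

text \<open>
  Characterizes the negative fractional powers in the definitions of \<open>\<beta>\<close> and \<open>\<phi>\<close> by a polynomial
  equation, so that the volume normalization can be handled by pure algebra.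
\<close>

lemma power_mult_eq_1_iff:
  fixes b y :: real
  assumes "b > 0" "y > 0" "n > 0"
  shows "b ^ n * y = 1 \<longleftrightarrow> b = y powr (- 1 / real n)"
proof
  assume "b ^ n * y = 1"
  then have "y = b powr (- real n)"
    using assms by (simp add: powr_minus powr_realpow field_simps)
  then show "b = y powr (- 1 / real n)"
    using assms by (simp add: powr_powr)
next
  assume "b = y powr (- 1 / real n)"
  then have "b ^ n = y powr (-1)"
    using assms by (simp add: powr_powr flip: powr_realpow)
  then show "b ^ n * y = 1"
    using assms by (simp add: powr_minus field_simps)
qed

section \<open>Unit-volume curves parameterized by a ratio of coordinates\<close>

text \<open>
  The common shape of the curves \<open>r\<^sub>p\<^sub>q\<close> (with \<open>b = \<beta>\<close>) and \<open>l\<^sub>k\<close> (with \<open>b = \<phi>\<close>): a point of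
  unit volume is determined by the ratio \<open>t\<close> of two coordinates and one of these coordinates.
\<close>

definition ratio_point :: "3 \<Rightarrow> 3 \<Rightarrow> (real \<Rightarrow> real) \<Rightarrow> real \<Rightarrow> real^3" where
  "ratio_point p q b t =
     (\<chi> m. if m = p then 1 / (t * (b t)\<^sup>2) else if m = q then t * b t else b t)"

lemma r_param_eq: "r_param a p q = ratio_point p q (beta a)"
  by (simp add: fun_eq_iff r_param_def ratio_point_def)

lemma l_param_eq: "l_param p q = ratio_point p q phi"
  by (simp add: fun_eq_iff l_param_def ratio_point_def)

lemma ratio_point_nth:
  assumes "{p, q, s} = (UNIV :: 3 set)"
  shows "ratio_point p q b t $ p = 1 / (t * (b t)\<^sup>2)" "ratio_point p q b t $ q = t * b t"
    "ratio_point p q b t $ s = b t"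
  using index3_distinct[OF assms] by (auto simp: ratio_point_def)

lemma ratio_point_unit_vol:
  assumes "{p, q, s} = UNIV" "t > 0" "b t > 0"
  shows "ratio_point p q b t \<in> unit_vol"
  using assms by (simp add: unit_vol_iff[OF assms(1)] ratio_point_nth[OF assms(1)] power2_eq_square)

text \<open>
  Every unit-volume metric lies on such a curve, provided that \<open>b\<close> returns the correct third
  coordinate for the ratio. Hence a parameterized set is identified by checking one equation.
\<close>

lemma unit_vol_eq_ratio_point:
  assumes ix: "{p, q, s} = UNIV" and x: "x \<in> unit_vol" and b: "b (x $ q / x $ s) = x $ s"
  shows "x = ratio_point p q b (x $ q / x $ s)"
  using x b unfolding vec3_eq[OF ix] ratio_point_nth[OF ix] unit_vol_iff[OF ix]
  by (auto simp: field_simps power2_eq_square)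

text \<open>
  The velocity cannot vanish: if the derivatives of \<open>t b(t)\<close> and of \<open>b(t)\<close> both vanished, then so
  would \<open>b(t)\<close>.
\<close>

lemma regular_param_ratio_point:
  assumes ix: "{p, q, s} = UNIV" and S: "S \<subseteq> {0<..}" and b: "\<And>t. t \<in> S \<Longrightarrow> b t > 0"
    and b': "\<And>t. t \<in> S \<Longrightarrow> (b has_real_derivative b' t) (at t within S)"
    and cont: "continuous_on S b'"
  shows "regular_param (ratio_point p q b) S"
proof -
  note d = index3_distinct[OF ix]
  (* The derivative of the curve, by the product and quotient rules. *)
  define D :: "real \<Rightarrow> real^3" where "D t = (\<chi> m. if m = p then - (b t + 2 * t * b' t) / (t\<^sup>2 * (b t) ^ 3)
    else if m = q then b t + t * b' t else b' t)" for t
  have contb: "continuous_on S b"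
    using b' by (meson DERIV_continuous continuous_on_eq_continuous_within)
  have nz: "t \<noteq> 0" "b t \<noteq> 0" if "t \<in> S" for t
    using S b that by fastforce+
  have "continuous_on S (\<lambda>t. D t $ m)" for m
    unfolding D_def using nz
    by (cases "m = p"; cases "m = q") (auto intro!: continuous_intros contb cont)
  then have 1: "continuous_on S D"
    using continuous_on_vec_lambda[of S "\<lambda>m t. D t $ m"] by simp
  have 2: "(ratio_point p q b has_vector_derivative D t) (at t within S)" if t: "t \<in> S" for t
  proof (rule has_vector_derivative_vecI)
    fix m
    have "((\<lambda>t. 1 / (t * (b t)\<^sup>2)) has_real_derivative - (b t + 2 * t * b' t) / (t\<^sup>2 * (b t) ^ 3)) (at t within S)"
      using nz[OF t]
      by (auto intro!: derivative_eq_intros b'[OF t] simp: field_simps power2_eq_square power3_eq_cube)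
    moreover have "((\<lambda>t. t * b t) has_real_derivative b t + t * b' t) (at t within S)"
      by (auto intro!: derivative_eq_intros b'[OF t])
    ultimately show "((\<lambda>t. ratio_point p q b t $ m) has_real_derivative D t $ m) (at t within S)"
      unfolding ratio_point_def D_def using b'[OF t] d by auto
  qed
  have 3: "D t \<noteq> 0" if t: "t \<in> S" for t
  proof
    assume 0: "D t = 0"
    have "D t $ q = 0" "D t $ s = 0"
      using 0 by simp_all
    then have "b t = 0"
      using d by (auto simp: D_def)
    with nz[OF t] show False by simp
  qed
  show ?thesis
    unfolding regular_param_def using 1 2 3 by blast
qed

section \<open>Regularity of the curves r\<close>

text \<open>
  For \<open>t \<le> a\<close> the polynomial equals \<open>t\<^sup>2\<close> times a sum of a positive and a nonnegative term. (Its
  smaller positive root lies strictly between \<open>a\<close> and \<open>2 a\<close>.)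
\<close>

lemma beta_poly_pos:
  fixes a t :: real
  assumes a: "0 < a" "a < 1/2" and t: "0 < t" "t \<le> a"
  shows "t ^ 4 - t ^ 3 / a + t\<^sup>2 > 0"
proof -
  have "t ^ 4 - t ^ 3 / a + t\<^sup>2 = t\<^sup>2 * (t\<^sup>2 + (a - t) / a)"
    using a by (simp add: field_simps power2_eq_square power3_eq_cube power4_eq_xxxx)
  moreover have "t\<^sup>2 + (a - t) / a > 0"
    using a t by (intro add_pos_nonneg) auto
  ultimately show ?thesis
    using t by simp
qed

lemma eq_beta_iff:
  assumes "b > 0" "t ^ 4 - t ^ 3 / a + t\<^sup>2 > 0"
  shows "b = beta a t \<longleftrightarrow> b ^ 6 * (t ^ 4 - t ^ 3 / a + t\<^sup>2) = 1"
  using power_mult_eq_1_iff[of b "t ^ 4 - t ^ 3 / a + t\<^sup>2" 6] assms unfolding beta_def by simp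

lemma beta_pos: "t ^ 4 - t ^ 3 / a + t\<^sup>2 > 0 \<Longrightarrow> beta a t > 0"
  unfolding beta_def by simp

lemma regular_param_r_param:
  assumes a: "0 < a" "a < 1/2" and ix: "{p, q, s} = UNIV"
  shows "regular_param (r_param a p q) {0<..a}"
  unfolding r_param_eq
proof (rule regular_param_ratio_point[OF ix])
  let ?P = "\<lambda>t::real. t ^ 4 - t ^ 3 / a + t\<^sup>2"
  let ?b' = "\<lambda>t::real. (- 1 / 6) * ?P t powr (- 1 / 6 - 1) * (4 * t ^ 3 - 3 * t\<^sup>2 / a + 2 * t)"
  have P: "?P t > 0" if "t \<in> {0<..a}" for t
    using beta_poly_pos[OF a] that by auto
  then show "beta a t > 0" if "t \<in> {0<..a}" for t
    using that beta_pos by blast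
  show "(beta a has_real_derivative ?b' t) (at t within {0<..a})" if "t \<in> {0<..a}" for t
  proof -
    have "(?P has_real_derivative 4 * t ^ 3 - 3 * t\<^sup>2 / a + 2 * t) (at t within {0<..a})"
      using a by (auto intro!: derivative_eq_intros simp: field_simps)
    then show ?thesis
      unfolding beta_def by (intro has_real_derivative_powr_within P that)
  qed
  show "continuous_on {0<..a} ?b'"
    by (intro continuous_intros) (use P a in \<open>auto simp: less_imp_neq[THEN not_sym]\<close>)
qed auto

section \<open>Signs on the cone where one lambda vanishes\<close>

text \<open>
  Eliminating \<open>a x\<^sub>p\<^sup>2\<close> by means of \<open>\<lambda>\<^sub>p = 0\<close> makes the other two polynomials split into linear
  factors.
\<close>

lemma lam_at_lam_zero:
  assumes ix: "{p, q, s} = UNIV" and 0: "lam a p x = 0"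
  shows "lam a q x = x $ s * (x $ p + x $ q - 2 * a * x $ s)"
    "lam a s x = x $ q * (x $ p + x $ s - 2 * a * x $ q)"
proof -
  have ix2: "{q, p, s} = UNIV" "{s, p, q} = UNIV"
    using ix by auto
  show "lam a q x = x $ s * (x $ p + x $ q - 2 * a * x $ s)"
    "lam a s x = x $ q * (x $ p + x $ s - 2 * a * x $ q)"
    using 0 unfolding lam_eq[OF ix] lam_eq[OF ix2(1)] lam_eq[OF ix2(2)]
    by (simp_all add: algebra_simps power2_eq_square)
qed

text \<open>
  By the previous factorization, the sign of \<open>\<lambda>\<^sub>q\<close> is decided by comparing \<open>x\<^sub>p\<close> with
  \<open>2 a x\<^sub>s - x\<^sub>q\<close>. The difference of their squares is linear in \<open>x\<^sub>q\<close> with root \<open>a x\<^sub>s\<close>, which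
  explains the endpoint \<open>t = a\<close> of the parameter interval.
\<close>

lemma lam_zero_sq:
  assumes ix: "{p, q, s} = UNIV" and 0: "lam a p x = 0"
  shows "a * ((x $ p)\<^sup>2 - (2 * a * x $ s - x $ q)\<^sup>2) = (1 - 4 * a\<^sup>2) * x $ s * (a * x $ s - x $ q)"
  using 0 unfolding lam_eq[OF ix] by (simp add: algebra_simps power2_eq_square power3_eq_cube)

lemma one_minus_four_square_pos: "0 < a \<Longrightarrow> a < 1/2 \<Longrightarrow> 1 - 4 * a\<^sup>2 > 0" for a :: real
  using abs_square_less_1[of "2*a"] by (simp add: power_mult_distrib)

lemma less_half_if_le:
  fixes a y z :: real
  assumes "a < 1/2" "y > 0" "z \<le> a * y"
  shows "z < (1/2) * y"
  using assms(3) mult_strict_right_mono[OF assms(1,2)] by simp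

text \<open>
  The signs of the other two \<open>\<lambda>\<close> along \<open>r\<^sub>p\<^sub>q\<close>: only \<open>\<lambda>\<^sub>q\<close> can vanish there, and only at the
  endpoint.
\<close>

lemma lam_sign_at_lam_zero:
  assumes a: "0 < a" "a < 1/2" and ix: "{p, q, s} = UNIV"
    and x: "x \<in> metrics" and 0: "lam a p x = 0" and le: "x $ q \<le> a * x $ s"
  shows "lam a s x > 0" "lam a q x \<ge> 0" "lam a q x = 0 \<longleftrightarrow> x $ q = a * x $ s"
proof -
  have pos: "x $ p > 0" "x $ q > 0" "x $ s > 0"
    using x metrics_iff[OF ix] by auto
  have "2 * a * x $ q < x $ s"
  proof -
    have "2 * a * x $ q \<le> x $ q" using a pos by auto
    also have "\<dots> < x $ s" using less_half_if_le[OF a(2) pos(3) le] pos by simp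
    finally show ?thesis .
  qed
  then show "lam a s x > 0"
    unfolding lam_at_lam_zero[OF ix 0] using pos by (intro mult_pos_pos) auto
  have "2 * a * x $ s - x $ q > 0" 
    using le mult_pos_pos[OF a(1) pos(3)] by linarith
  note sq = lam_zero_sq[OF ix 0]
  have "a * ((x $ p)\<^sup>2 - (2 * a * x $ s - x $ q)\<^sup>2) \<ge> 0"
    unfolding sq using le pos one_minus_four_square_pos[OF a] by auto
  then have "(2 * a * x $ s - x $ q)\<^sup>2 \<le> (x $ p)\<^sup>2"
    using a by (simp add: zero_le_mult_iff)
  then have "2 * a * x $ s - x $ q \<le> x $ p"
    using pos by (meson power2_le_imp_le less_imp_le)
  then show "lam a q x \<ge> 0"
    unfolding lam_at_lam_zero[OF ix 0] using pos by (intro mult_nonneg_nonneg) auto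
  have "lam a q x = 0 \<longleftrightarrow> x $ p = 2 * a * x $ s - x $ q"
    unfolding lam_at_lam_zero[OF ix 0] using pos by auto
  also have "\<dots> \<longleftrightarrow> (x $ p)\<^sup>2 = (2 * a * x $ s - x $ q)\<^sup>2"
    using pos \<open>2 * a * x $ s - x $ q > 0\<close> by (simp add: power2_eq_iff_nonneg)
  also have "\<dots> \<longleftrightarrow> a * ((x $ p)\<^sup>2 - (2 * a * x $ s - x $ q)\<^sup>2) = 0"
    using a by simp
  also have "\<dots> \<longleftrightarrow> x $ q = a * x $ s"
    unfolding sq using pos one_minus_four_square_pos[OF a] by auto
  finally show "lam a q x = 0 \<longleftrightarrow> x $ q = a * x $ s" .
qed

text \<open>
  The converse: beyond the ratio \<open>a\<close> the polynomial \<open>\<lambda>\<^sub>q\<close> is negative. If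
  \<open>x\<^sub>q > 2 a x\<^sub>s\<close>, the comparison of squares says nothing, but then \<open>\<lambda>\<^sub>p = 0\<close> would make
  \<open>a x\<^sub>p\<^sup>2\<close> negative: for \<open>x\<^sub>s = 1\<close>, the quadratic \<open>a y\<^sup>2 - y + a\<close> in \<open>y = x\<^sub>q\<close> is negative on \<open>]2 a, 1[\<close>.
\<close>

lemma le_if_lam_nonneg:
  assumes a: "0 < a" "a < 1/2" and ix: "{p, q, s} = UNIV"
    and x: "x \<in> metrics" and 0: "lam a p x = 0" and less: "x $ q < x $ s"
    and nn: "lam a q x \<ge> 0"
  shows "x $ q \<le> a * x $ s"
proof (rule ccontr)
  assume gt: "\<not> x $ q \<le> a * x $ s"
  have pos: "x $ p > 0" "x $ q > 0" "x $ s > 0"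
    using x metrics_iff[OF ix] by auto
  have ge: "2 * a * x $ s - x $ q \<le> x $ p"
    using nn pos unfolding lam_at_lam_zero[OF ix 0] by (simp add: zero_le_mult_iff)
  have "a * ((x $ p)\<^sup>2 - (2 * a * x $ s - x $ q)\<^sup>2) < 0"
    unfolding lam_zero_sq[OF ix 0] using gt pos one_minus_four_square_pos[OF a] by (intro mult_pos_neg mult_pos_pos) auto
  then have "(x $ p)\<^sup>2 < (2 * a * x $ s - x $ q)\<^sup>2"
    using a by (simp add: mult_less_0_iff)
  then have neg: "2 * a * x $ s < x $ q"
    using ge pos by (smt (verit) power_mono)
  have "0 < a * (x $ p)\<^sup>2"
    using a pos by simp
  also have "\<dots> = a * (x $ q)\<^sup>2 + a * (x $ s)\<^sup>2 - x $ q * x $ s"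
    using 0 unfolding lam_eq[OF ix] by (simp add: algebra_simps)
  also have "\<dots> \<le> a * (x $ q * x $ s) + a * (x $ s)\<^sup>2 - x $ q * x $ s"
    using less a pos by (simp add: power2_eq_square)
  also have "\<dots> = x $ s * (a * x $ s - (1 - a) * x $ q)"
    by (simp add: algebra_simps power2_eq_square)
  also have "\<dots> < 0"
  proof (rule mult_pos_neg)
    have "a * x $ s < (1/2) * x $ q"
      using neg by simp
    also have "\<dots> < (1 - a) * x $ q"
      using a pos by (intro mult_strict_right_mono) auto
    finally show "a * x $ s - (1 - a) * x $ q < 0"
      by simp
  qed (use pos in simp)
  finally show False .
qed

section \<open>Implicit description of the curves r\<close>

text \<open>
  The implicit description of \<open>r\<^sub>p\<^sub>q\<close>. With \<open>t = x\<^sub>q / x\<^sub>s\<close>, the equation \<open>\<lambda>\<^sub>p = 0\<close> reads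
  \<open>x\<^sub>p\<^sup>2 = x\<^sub>s\<^sup>2 (t\<^sup>2 - t/a + 1)\<close>; together with unit volume this is the equation
  that defines \<open>\<beta>(t)\<close>, with \<open>x\<^sub>s\<close> in its place.
\<close>

lemma r_comp_iff:
  assumes a: "0 < a" "a < 1/2" and ix: "{p, q, s} = UNIV"
  shows "x \<in> r_comp a p q \<longleftrightarrow> x \<in> unit_vol \<and> lam a p x = 0 \<and> x $ q \<le> a * x $ s"
proof
  assume "x \<in> r_comp a p q"
  then obtain t where t: "0 < t" "t \<le> a" and x: "x = ratio_point p q (beta a) t"
    unfolding r_comp_def r_param_eq by auto
  define b where "b = beta a t"
  note P = beta_poly_pos[OF a t]
  have b: "b > 0" "b ^ 6 * (t ^ 4 - t ^ 3 / a + t\<^sup>2) = 1"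
    using beta_pos[OF P] eq_beta_iff[OF _ P, of b] unfolding b_def by auto
  have c: "x $ p = 1 / (t * b\<^sup>2)" "x $ q = t * b" "x $ s = b"
    unfolding x ratio_point_nth[OF ix] b_def by auto
  have "a * (1 / (t * b\<^sup>2))\<^sup>2 = a * (b ^ 6 * (t ^ 4 - t ^ 3 / a + t\<^sup>2)) / (t * b\<^sup>2)\<^sup>2"
    unfolding b(2) by (simp add: power_divide)
  also have "\<dots> = a * b\<^sup>2 * (t\<^sup>2 - t / a + 1)"
    using a t b(1) by (simp add: field_simps) algebra
  finally have "lam a p x = 0"
    unfolding lam_eq[OF ix] c using a by (simp add: algebra_simps power2_eq_square)
  moreover have "x \<in> unit_vol"
    unfolding x using ratio_point_unit_vol[where b = "beta a", OF ix t(1) beta_pos[OF P]] .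
  ultimately show "x \<in> unit_vol \<and> lam a p x = 0 \<and> x $ q \<le> a * x $ s"
    using c t b(1) by simp
next
  assume *: "x \<in> unit_vol \<and> lam a p x = 0 \<and> x $ q \<le> a * x $ s"
  then have pos: "x $ p > 0" "x $ q > 0" "x $ s > 0" and vol: "x $ p * x $ q * x $ s = 1"
    using unit_vol_iff[OF ix] by auto
  define t where "t = x $ q / x $ s"
  have t: "0 < t" "t \<le> a"
    using * pos by (auto simp: t_def field_simps)
  have xq: "x $ q = t * x $ s"
    using pos by (simp add: t_def)
  note P = beta_poly_pos[OF a t]
  have "(x $ p)\<^sup>2 = (x $ s)\<^sup>2 * (t\<^sup>2 - t / a + 1)"
    using * a unfolding lam_eq[OF ix] xq by (simp add: field_simps power2_eq_square)
  then have "(x $ p * x $ q * x $ s)\<^sup>2 = (x $ s) ^ 6 * (t ^ 4 - t ^ 3 / a + t\<^sup>2)"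
    unfolding power_mult_distrib unfolding xq using a by (simp add: field_simps) algebra
  then have "x $ s = beta a t"
    unfolding eq_beta_iff[OF pos(3) P] vol by simp
  then have "x = ratio_point p q (beta a) t"
    using unit_vol_eq_ratio_point[OF ix, of x "beta a"] * unfolding t_def by auto
  with t show "x \<in> r_comp a p q"
    unfolding r_comp_def r_param_eq by auto
qed

lemma r_curve_eq_Un:
  assumes ix: "{p, q, s} = UNIV"
  shows "r_curve a p = r_comp a p q \<union> r_comp a p s"
proof -
  have "- {p} = {q, s}"
    using ix index3_distinct[OF ix] by auto
  then show ?thesis
    by (simp add: r_curve_def)
qed

lemma unit_vol_metrics: "x \<in> unit_vol \<Longrightarrow> x \<in> metrics"
  by (simp add: unit_vol_def)

text \<open>
  The two components together exhaust \<open>{\<lambda>\<^sub>p = 0, all \<lambda> \<ge> 0}\<close>, because \<open>\<lambda>\<^sub>p\<close> is positive where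
  \<open>x\<^sub>q = x\<^sub>s\<close>, so that one of the two strict inequalities holds.
\<close>

lemma r_curve_iff:
  assumes a: "0 < a" "a < 1/2"
  shows "x \<in> r_curve a p \<longleftrightarrow> x \<in> unit_vol \<and> lam a p x = 0 \<and> (\<forall>m. lam a m x \<ge> 0)"
proof -
  obtain q s where ix: "{p, q, s} = UNIV"
    using index3_succ by blast
  then have ix': "{p, s, q} = UNIV"
    by auto
  note all = all_index3[OF ix, where P = "\<lambda>m. lam a m x \<ge> 0"]
  show ?thesis
  proof
    assume "x \<in> r_curve a p"
    then consider "x \<in> r_comp a p q" | "x \<in> r_comp a p s"
      unfolding r_curve_eq_Un[OF ix] by blast
    then show "x \<in> unit_vol \<and> lam a p x = 0 \<and> (\<forall>m. lam a m x \<ge> 0)"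
    proof cases
      case 1
      then have *: "x \<in> unit_vol" "lam a p x = 0" "x $ q \<le> a * x $ s"
        unfolding r_comp_iff[OF a ix] by auto
      show ?thesis
        unfolding all using * lam_sign_at_lam_zero(1,2)[OF a ix unit_vol_metrics *(2,3)] by simp
    next
      case 2
      then have *: "x \<in> unit_vol" "lam a p x = 0" "x $ s \<le> a * x $ q"
        unfolding r_comp_iff[OF a ix'] by auto
      show ?thesis
        unfolding all using * lam_sign_at_lam_zero(1,2)[OF a ix' unit_vol_metrics *(2,3)] by simp
    qed
  next
    assume *: "x \<in> unit_vol \<and> lam a p x = 0 \<and> (\<forall>m. lam a m x \<ge> 0)"
    then have m: "x \<in> metrics" and 0: "lam a p x = 0"
      by (auto simp: unit_vol_metrics)
    then have pos: "x $ p > 0" "x $ q > 0" "x $ s > 0"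
      using metrics_iff[OF ix] by auto
    have "x $ q \<noteq> x $ s"
    proof
      assume "x $ q = x $ s"
      then have "a * (x $ p)\<^sup>2 + (1 - 2 * a) * (x $ s)\<^sup>2 = 0"
        using 0 unfolding lam_eq[OF ix] by (simp add: algebra_simps power2_eq_square)
      moreover have "a * (x $ p)\<^sup>2 + (1 - 2 * a) * (x $ s)\<^sup>2 > 0"
        using a pos by (intro add_pos_pos) auto
      ultimately show False by simp
    qed
    then consider "x $ q < x $ s" | "x $ s < x $ q"
      by linarith
    then show "x \<in> r_curve a p"
    proof cases
      case 1
      then have "x \<in> r_comp a p q"
        unfolding r_comp_iff[OF a ix] using le_if_lam_nonneg[OF a ix m 0] * by blast
      then show ?thesis
        unfolding r_curve_eq_Un[OF ix] by blast
    next
      case 2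
      then have "x \<in> r_comp a p s"
        unfolding r_comp_iff[OF a ix'] using le_if_lam_nonneg[OF a ix' m 0] * by blast
      then show ?thesis
        unfolding r_curve_eq_Un[OF ix] by blast
    qed
  qed
qed

section \<open>The boundary of the region of positive Ricci curvature\<close>

lemma continuous_on_lam: "continuous_on S (lam a m)"
  unfolding lam_def Let_def by (intro continuous_intros)

text \<open>
  Enlarging the smaller coordinate \<open>x\<^sub>q\<close> makes \<open>\<lambda>\<^sub>p\<close> and \<open>\<lambda>\<^sub>q\<close> strictly increase, while
  \<open>\<lambda>\<^sub>s\<close> stays positive by continuity. This direction works at the endpoint, where two of the \<open>\<lambda>\<close>
  vanish, as well as at the other points. The \<open>\<lambda>\<close> being homogeneous, rescaling to unit volume
  preserves their signs.
\<close>

lemma r_curve_subset_closure: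
  assumes a: "0 < a" "a < 1/2" and x: "x \<in> r_curve a p"
  shows "x \<in> closure (unit_ricci_pos a)"
proof -
  obtain q s where ix: "{p, q, s} = UNIV" and xc: "x \<in> r_comp a p q"
  proof -
    obtain q s where ix: "{p, q, s} = UNIV"
      using index3_succ by blast
    then have ix': "{p, s, q} = UNIV"
      by auto
    show ?thesis
      using x that[OF ix] that[OF ix'] unfolding r_curve_eq_Un[OF ix] by blast
  qed
  note d = index3_distinct[OF ix]
  have 0: "lam a p x = 0" and le: "x $ q \<le> a * x $ s" and v: "x \<in> unit_vol"
    using xc unfolding r_comp_iff[OF a ix] by auto
  have m: "x \<in> metrics"
    using v by (rule unit_vol_metrics)
  then have pos: "x $ p > 0" "x $ q > 0" "x $ s > 0"
    using metrics_iff[OF ix] by auto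
  have vol: "x $ p * x $ q * x $ s = 1"
    using v unit_vol_iff[OF ix] by auto
  note sg = lam_sign_at_lam_zero[OF a ix m 0 le]
  have ix2: "{q, p, s} = UNIV" "{s, p, q} = UNIV"
    using ix by auto
  (* The perturbed point, and the factor that rescales it to unit volume. *)
  define w where "w = (\<lambda>e::real. x + e *\<^sub>R axis q 1)"
  define c where "c = (\<lambda>e. (w e $ p * w e $ q * w e $ s) powr (-1/3))"
  have w: "w e $ p = x $ p" "w e $ q = x $ q + e" "w e $ s = x $ s" for e
    using d by (auto simp: w_def axis_def)
  have cont: "continuous (at_right (0::real)) w" "continuous (at_right 0) c"
  proof -
    have "isCont w 0"
      unfolding w_def by (intro continuous_intros)
    moreover have "isCont c 0"
      unfolding c_def w using pos by (intro continuous_intros) auto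
    ultimately show "continuous (at_right 0) w" "continuous (at_right 0) c"
      by (auto intro: continuous_at_imp_continuous_at_within)
  qed
  have "continuous (at_right 0) (\<lambda>e. lam a s (w e))"
    unfolding lam_eq[OF ix2(2)] by (intro continuous_intros cont)
  then have "((\<lambda>e. lam a s (w e)) \<longlongrightarrow> lam a s (w 0)) (at_right 0)"
    by (simp add: continuous_within)
  moreover have "w 0 = x"
    by (simp add: w_def)
  ultimately have ev1: "\<forall>\<^sub>F e in at_right 0. lam a s (w e) > 0"
    using sg(1) by (auto intro: order_tendstoD)
  have "x $ q < (1/2) * x $ s"
    by (rule less_half_if_le[OF a(2) pos(3) le])
  then have ev2: "\<forall>\<^sub>F e in at_right 0. x $ q + e < (1/2) * x $ s"
    by (intro eventually_at_rightI[of 0 "(1/2) * x $ s - x $ q"]) auto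
  have ev3: "\<forall>\<^sub>F e::real in at_right 0. e > 0"
    by (simp add: eventually_at_filter)
  have "\<forall>\<^sub>F e in at_right 0. c e *\<^sub>R w e \<in> unit_ricci_pos a"
    using ev1 ev2 ev3
  proof eventually_elim
    case (elim e)
    have P: "w e $ p * w e $ q * w e $ s > 0"
      unfolding w using pos elim by (intro mult_pos_pos) auto
    have cp: "c e > 0"
      unfolding c_def powr_gt_zero using P by (rule less_imp_neq[THEN not_sym])
    have "c e ^ 3 * (w e $ p * w e $ q * w e $ s) = 1"
      using power_mult_eq_1_iff[OF cp P, of 3] unfolding c_def by simp
    moreover have "(c e * w e $ p) * (c e * w e $ q) * (c e * w e $ s)
        = c e ^ 3 * (w e $ p * w e $ q * w e $ s)"
      by (simp add: power3_eq_cube)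
    moreover have "w e $ p > 0" "w e $ q > 0" "w e $ s > 0"
      unfolding w using pos elim by auto
    ultimately have "c e *\<^sub>R w e \<in> unit_vol"
      using cp unfolding unit_vol_iff[OF ix] by simp
    have scale: "lam a m (c e *\<^sub>R w e) = (c e)\<^sup>2 * lam a m (w e)" for m
      by (simp add: lam_def Let_def algebra_simps power2_eq_square)
    have "lam a p (w e) = lam a p x + e * (x $ s - a * (2 * x $ q + e))"
      by (simp add: lam_eq[OF ix] w algebra_simps power2_eq_square)
    moreover have "a * (2 * x $ q + e) < x $ s"
    proof -
      have "a * (2 * x $ q + e) \<le> 1 * (2 * x $ q + e)"
        using a pos elim by (intro mult_right_mono) auto
      also have "\<dots> < x $ s" using elim by simp
      finally show ?thesis .
    qed
    ultimately have lp: "lam a p (w e) > 0"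
      using 0 elim by simp
    have "lam a q (w e) = lam a q x + a * e * (2 * x $ q + e)"
      by (simp add: lam_eq[OF ix2(1)] w algebra_simps power2_eq_square)
    moreover have "a * e * (2 * x $ q + e) > 0"
      using a pos elim by (intro mult_pos_pos) auto
    ultimately have "lam a q (w e) > 0"
      using sg(2) by linarith
    with lp elim(1) have "\<forall>m. lam a m (w e) > 0"
      using all_index3[OF ix, of "\<lambda>m. lam a m (w e) > 0"] by simp
    then show ?case
      using cp \<open>c e *\<^sub>R w e \<in> unit_vol\<close> by (simp add: unit_ricci_pos_iff scale)
  qed
  moreover have "((\<lambda>e. c e *\<^sub>R w e) \<longlongrightarrow> c 0 *\<^sub>R w 0) (at_right 0)"
    using continuous_scaleR[OF cont(2,1)] by (simp add: continuous_within)
  then have "((\<lambda>e. c e *\<^sub>R w e) \<longlongrightarrow> x) (at_right 0)"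
    using \<open>w 0 = x\<close> vol by (simp add: c_def)
  ultimately show ?thesis
    using closure_subset[of "unit_ricci_pos a"]
    by (intro Lim_in_closed_set[of "closure (unit_ricci_pos a)" _ "at_right (0::real)"])
      (auto elim!: eventually_mono simp: subset_iff)
qed

text \<open>
  The region is relatively open, so its frontier consists of the points of its closure at which
  some \<open>\<lambda>\<^sub>p\<close> fails to be positive. By continuity all \<open>\<lambda>\<close> are nonnegative there, which is the
  description of \<open>r\<^sub>p\<close>.
\<close>

lemma frontier_unit_ricci_pos:
  assumes a: "0 < a" "a < 1/2"
  shows "top_of_set unit_vol frontier_of unit_ricci_pos a = (\<Union>p. r_curve a p)"
proof -
  let ?U = "\<Inter>m. {x. lam a m x > 0}"
  have "open ?U"
    by (intro open_INT finite ballI open_Collect_less continuous_on_lam continuous_on_const)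
  moreover have eq: "unit_ricci_pos a = unit_vol \<inter> ?U"
    by (auto simp: unit_ricci_pos_iff)
  ultimately have op: "openin (top_of_set unit_vol) (unit_ricci_pos a)"
    by (simp add: openin_open_Int)
  have cl: "top_of_set unit_vol closure_of unit_ricci_pos a = unit_vol \<inter> closure (unit_ricci_pos a)"
    unfolding closure_of_subtopology eq by (simp add: Int_absorb1 Int_absorb2 flip: Int_assoc)
  have fr: "top_of_set unit_vol frontier_of unit_ricci_pos a
      = unit_vol \<inter> closure (unit_ricci_pos a) - unit_ricci_pos a"
    unfolding frontier_of_openin[OF op] cl ..
  show ?thesis
  proof (rule set_eqI)
    fix x
    have nn: "lam a m x \<ge> 0" if "x \<in> closure (unit_ricci_pos a)" for m
    proof -
      have "closed {x. lam a m x \<ge> 0}"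
        by (intro closed_Collect_le continuous_on_lam continuous_on_const)
      moreover have "unit_ricci_pos a \<subseteq> {x. lam a m x \<ge> 0}"
        by (auto simp: unit_ricci_pos_iff intro: less_imp_le)
      ultimately show ?thesis
        using that closure_minimal by blast
    qed
    show "x \<in> top_of_set unit_vol frontier_of unit_ricci_pos a \<longleftrightarrow> x \<in> (\<Union>p. r_curve a p)"
    proof
      assume "x \<in> top_of_set unit_vol frontier_of unit_ricci_pos a"
      then have x: "x \<in> unit_vol" "x \<in> closure (unit_ricci_pos a)" "x \<notin> unit_ricci_pos a"
        unfolding fr by auto
      then obtain m where "\<not> lam a m x > 0"
        using unit_ricci_pos_iff by blast
      then have "lam a m x = 0"
        using nn[OF x(2), of m] by simp
      then show "x \<in> (\<Union>p. r_curve a p)"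
        using r_curve_iff[OF a] x(1) nn[OF x(2)] by blast
    next
      assume "x \<in> (\<Union>p. r_curve a p)"
      then obtain p where p: "x \<in> r_curve a p" by blast
      then have "x \<in> unit_vol" "x \<notin> unit_ricci_pos a"
        unfolding r_curve_iff[OF a] unit_ricci_pos_iff by (metis less_irrefl)+
      then show "x \<in> top_of_set unit_vol frontier_of unit_ricci_pos a"
        unfolding fr using r_curve_subset_closure[OF a p] by auto
    qed
  qed
qed

section \<open>Connected components of the curves r\<close>

lemma connected_r_comp:
  assumes a: "0 < a" "a < 1/2" and ix: "{p, q, s} = UNIV"
  shows "connected (r_comp a p q)"
proof -
  obtain g' where "\<forall>t\<in>{0<..a}. (r_param a p q has_vector_derivative g' t) (at t within {0<..a})"
    using regular_param_r_param[OF a ix] unfolding regular_param_def by blast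
  then have "continuous_on {0<..a} (r_param a p q)"
    unfolding continuous_on_eq_continuous_within
    using has_vector_derivative_continuous by blast
  then show ?thesis
    unfolding r_comp_def by (intro connected_continuous_image) auto
qed

lemma r_comp_nonempty: "0 < a \<Longrightarrow> r_comp a p q \<noteq> {}"
  unfolding r_comp_def by simp

text \<open>
  This strict inequality separates the two components of \<open>r\<^sub>p\<close> by the plane \<open>x\<^sub>q = x\<^sub>s\<close>.
\<close>

lemma r_comp_less:
  assumes a: "0 < a" "a < 1/2" and ix: "{p, q, s} = UNIV" and x: "x \<in> r_comp a p q"
  shows "x $ q < x $ s"
proof -
  have "x $ q \<le> a * x $ s" "x $ s > 0"
    using x unfolding r_comp_iff[OF a ix] unit_vol_iff[OF ix] by auto
  then show ?thesis
    using less_half_if_le[OF a(2)] by force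
qed

text \<open>
  A connected subset of the union that contains one part cannot meet the open set around the other
  part.
\<close>

lemma components_separated_Un:
  assumes "connected A" "connected B" "A \<noteq> {}" "B \<noteq> {}"
    and "open U" "open V" "A \<subseteq> U" "B \<subseteq> V" "U \<inter> V = {}"
  shows "components (A \<union> B) = {A, B}"
proof -
  have *: "A \<in> components (A \<union> B)" 
    if A: "connected A" "A \<noteq> {}" "open U" "open V" "A \<subseteq> U" "B \<subseteq> V" "U \<inter> V = {}" for A B U V :: "'a set"
    unfolding in_components_maximal
  proof (intro conjI allI impI)
    fix C assume C: "C \<noteq> {} \<and> A \<subseteq> C \<and> C \<subseteq> A \<union> B \<and> connected C"
    then have "V \<inter> C = {}"
      using A connectedD[of C U V] by blast
    then show "C = A"
      using C A by blast
  qed (use A in simp_all)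
  have "A \<in> components (A \<union> B)" "B \<in> components (A \<union> B)"
    using *[of A U V B] *[of B V U A] assms by (auto simp: Un_commute Int_commute)
  moreover have "C = A \<or> C = B" if C: "C \<in> components (A \<union> B)" for C
  proof -
    have "C \<noteq> {}" "C \<subseteq> A \<union> B"
      using in_components_nonempty[OF C] in_components_subset[OF C] .
    then have "C \<inter> A \<noteq> {} \<or> C \<inter> B \<noteq> {}"
      by blast
    then show ?thesis
      using components_eq C \<open>A \<in> _\<close> \<open>B \<in> _\<close> by blast
  qed
  ultimately show ?thesis by blast
qed

lemma components_r_curve:
  assumes a: "0 < a" "a < 1/2" and ix: "{p, q, s} = UNIV"
  shows "components (r_curve a p) = {r_comp a p q, r_comp a p s}" "r_comp a p q \<noteq> r_comp a p s"
proof -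
  have ix': "{p, s, q} = UNIV"
    using ix by auto
  let ?U = "{x::real^3. x $ q < x $ s}" and ?V = "{x::real^3. x $ s < x $ q}"
  have sub: "r_comp a p q \<subseteq> ?U" "r_comp a p s \<subseteq> ?V"
    using r_comp_less[OF a ix] r_comp_less[OF a ix'] by auto
  then show "r_comp a p q \<noteq> r_comp a p s"
    using r_comp_nonempty[OF a(1), of p q] by fastforce
  show "components (r_curve a p) = {r_comp a p q, r_comp a p s}"
    unfolding r_curve_eq_Un[OF ix]
  proof (rule components_separated_Un[OF connected_r_comp[OF a ix] connected_r_comp[OF a ix'] _ _ _ _ sub])
    show "open ?U" "open ?V"
      by (intro open_Collect_less continuous_intros)+
  qed (auto simp: r_comp_nonempty[OF a(1)])
qed

section \<open>The points P and the curves I\<close>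

lemma P_point_nth:
  assumes ix: "{i, j, k} = UNIV"
  shows "P_point a i j $ i = a powr (1/3)" "P_point a i j $ j = a powr (1/3)"
    "P_point a i j $ k = a powr (-2/3)"
  using index3_distinct[OF ix] by (auto simp: P_point_def)

lemma P_point_commute: "P_point a i j = P_point a j i"
  by (simp add: P_point_def disj_commute)

lemma I_point_nth:
  assumes ix: "{i, j, k} = UNIV"
  shows "I_point k p $ i = p" "I_point k p $ j = p" "I_point k p $ k = 1 / p\<^sup>2"
  using index3_distinct[OF ix] by (auto simp: I_point_def)

text \<open>
  The two ratios \<open>x\<^sub>i = x\<^sub>j = a x\<^sub>k\<close> and the volume condition \<open>a\<^sup>2 x\<^sub>k\<^sup>3 = 1\<close> determine the point.
\<close>

lemma P_point_eqI:
  assumes a: "0 < a" and ix: "{i, j, k} = UNIV" and x: "x \<in> unit_vol"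
    and eq: "x $ i = a * x $ k" "x $ j = a * x $ k"
  shows "x = P_point a i j"
proof -
  have pos: "x $ k > 0" and vol: "x $ i * x $ j * x $ k = 1"
    using x unfolding unit_vol_iff[OF ix] by auto
  have "x $ k ^ 3 * a\<^sup>2 = 1"
    using vol unfolding eq by (simp add: power2_eq_square power3_eq_cube mult_ac)
  then have "x $ k = (a\<^sup>2) powr (- 1 / 3)"
    using power_mult_eq_1_iff[OF pos, of "a\<^sup>2" 3] a by simp
  also have "\<dots> = a powr (-2/3)"
    using a powr_powr[of a 2 "-1/3"] by simp
  finally have k: "x $ k = a powr (-2/3)" .
  have "a * a powr (-2/3) = a powr (1/3)"
    using a powr_add[of a 1 "-2/3"] by simp
  then show ?thesis
    unfolding vec3_eq[OF ix] P_point_nth[OF ix] eq k by simp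
qed

lemma P_point_props:
  assumes a: "0 < a" and ix: "{i, j, k} = UNIV"
  shows "P_point a i j \<in> unit_vol" "P_point a i j $ i = a * P_point a i j $ k"
    "P_point a i j $ j = a * P_point a i j $ k"
proof -
  have 1: "a * a powr (-2/3) = a powr (1/3)"
    using a powr_add[of a 1 "-2/3"] by simp
  then show "P_point a i j $ i = a * P_point a i j $ k"
    "P_point a i j $ j = a * P_point a i j $ k"
    unfolding P_point_nth[OF ix] by simp_all
  have "a powr (1/3) * a powr (1/3) * a powr (-2/3) = 1"
    using a by (simp flip: powr_add)
  then show "P_point a i j \<in> unit_vol"
    unfolding unit_vol_iff[OF ix] P_point_nth[OF ix] using a by simp
qed

lemma P_point_in_r_comp:
  assumes a: "0 < a" "a < 1/2" and ix: "{i, j, k} = UNIV"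
  shows "P_point a i j \<in> r_comp a i j"
proof -
  note P = P_point_props[OF a(1) ix]
  have "lam a i (P_point a i j) = 0"
    unfolding lam_eq[OF ix] P(2,3) by (simp add: power2_eq_square algebra_simps)
  then show ?thesis
    unfolding r_comp_iff[OF a ix] using P by simp
qed

text \<open>
  On \<open>r\<^sub>i\<^sub>k\<close> the polynomial \<open>\<lambda>\<^sub>j\<close> is positive, so a common point lies on \<open>r\<^sub>i\<^sub>j\<close>; there
  \<open>\<lambda>\<^sub>j\<close> vanishes only at the endpoint.
\<close>

lemma r_curves_Int:
  assumes a: "0 < a" "a < 1/2" and ix: "{i, j, k} = UNIV"
  shows "r_curve a i \<inter> r_curve a j = {P_point a i j}"
proof -
  have ix2: "{j, i, k} = UNIV" "{i, k, j} = UNIV"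
    using ix by auto
  have "x = P_point a i j" if x: "x \<in> r_curve a i" "x \<in> r_curve a j" for x
  proof -
    have v: "x \<in> unit_vol" and li: "lam a i x = 0" and lj: "lam a j x = 0"
      using x unfolding r_curve_iff[OF a] by auto
    have m: "x \<in> metrics"
      using v by (rule unit_vol_metrics)
    have "x \<notin> r_comp a i k"
      using lam_sign_at_lam_zero(1)[OF a ix2(2) m li] lj unfolding r_comp_iff[OF a ix2(2)] by auto
    then have "x \<in> r_comp a i j"
      using x(1) unfolding r_curve_eq_Un[OF ix] by blast
    then have xj: "x $ j = a * x $ k"
      using lam_sign_at_lam_zero(3)[OF a ix m li] lj unfolding r_comp_iff[OF a ix] by blast
    have "x $ k > 0" "x $ i > 0"
      using m metrics_iff[OF ix] by auto
    moreover have "x $ k * (x $ i - a * x $ k) = 0"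
      using lj unfolding lam_at_lam_zero(1)[OF ix li] xj by (simp add: algebra_simps)
    ultimately show ?thesis
      using xj by (intro P_point_eqI[OF a(1) ix v]) auto
  qed
  moreover have "P_point a i j \<in> r_curve a i" "P_point a i j \<in> r_curve a j"
    using P_point_in_r_comp[OF a ix] P_point_in_r_comp[OF a ix2(1)]
    unfolding r_curve_eq_Un[OF ix] r_curve_eq_Un[OF ix2(1)] P_point_commute[of a j i] by blast+
  ultimately show ?thesis by blast
qed

lemma I_curve_Int_r_comp:
  assumes a: "0 < a" "a < 1/2" and ix: "{i, j, k} = UNIV"
  shows "I_curve k \<inter> r_comp a i j = {P_point a i j}"
proof -
  have "x = P_point a i j" if I: "x \<in> I_curve k" and x: "x \<in> r_comp a i j" for x
  proof -
    have v: "x \<in> unit_vol" and li: "lam a i x = 0"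
      using x unfolding r_comp_iff[OF a ix] by auto
    have eq: "x $ i = x $ j"
      using I unfolding I_curve_def by (auto simp: I_point_nth[OF ix])
    have "x $ k > 0"
      using v unfolding unit_vol_iff[OF ix] by auto
    moreover have "x $ k * (x $ j - a * x $ k) = 0"
      using li unfolding lam_eq[OF ix] eq by (simp add: algebra_simps power2_eq_square)
    ultimately show ?thesis
      using eq by (intro P_point_eqI[OF a(1) ix v]) auto
  qed
  moreover have "P_point a i j \<in> I_curve k"
  proof -
    have "P_point a i j = I_point k (a powr (1/3))"
      unfolding vec3_eq[OF ix] I_point_nth[OF ix] P_point_nth[OF ix]
      using a by (simp add: powr_powr powr_minus field_simps flip: powr_realpow)
    then show ?thesis
      unfolding I_curve_def using a by auto
  qed
  ultimately show ?thesis
    using P_point_in_r_comp[OF a ix] by blast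
qed

text \<open>
  On \<open>r\<^sub>i\<^sub>k\<close> one has \<open>\<beta>(t) \<approx> t powr (-1/3)\<close> for small \<open>t\<close>, so the point with \<open>x\<^sub>j\<close> close to \<open>p\<close>
  has the parameter \<open>t = 1/p\<^sup>3\<close>. For this choice all three coordinate differences tend to 0,
  those of \<open>x\<^sub>i\<close> and \<open>x\<^sub>j\<close> at the rate \<open>1/p\<^sup>2\<close>.
\<close>

lemma infdist_I_r_comp:
  assumes a: "0 < a" "a < 1/2" and ix: "{i, j, k} = UNIV"
  shows "((\<lambda>p. infdist (I_point k p) (r_comp a i k)) \<longlongrightarrow> 0) at_top"
proof -
  have ix2: "{i, k, j} = UNIV"
    using ix by auto
  let ?t = "\<lambda>p::real. 1 / p ^ 3"
  let ?R = "\<lambda>p. r_param a i k (?t p)"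
  have 1: "((\<lambda>p. I_point k p - ?R p) \<longlongrightarrow> 0) at_top"
  proof (rule vec_tendstoI)
    fix m
    have i: "((\<lambda>p. p - 1 / (?t p * (beta a (?t p))\<^sup>2)) \<longlongrightarrow> 0) at_top"
      unfolding beta_def using a by real_asymp
    have j: "((\<lambda>p. p - beta a (?t p)) \<longlongrightarrow> 0) at_top"
      unfolding beta_def using a by real_asymp
    have k: "((\<lambda>p. 1 / p\<^sup>2 - ?t p * beta a (?t p)) \<longlongrightarrow> 0) at_top"
      unfolding beta_def using a by real_asymp
    have "m = i \<or> m = j \<or> m = k"
      using ix by auto
    then show "((\<lambda>p. (I_point k p - ?R p) $ m) \<longlongrightarrow> 0 $ m) at_top"
      using i j k by (auto simp: I_point_nth[OF ix] r_param_eq ratio_point_nth[OF ix2])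
  qed
  have "\<forall>\<^sub>F p in at_top. ?R p \<in> r_comp a i k"
  proof -
    have "\<forall>\<^sub>F p in at_top. ?t p \<le> a"
      using a by real_asymp
    with eventually_gt_at_top[of 0] show ?thesis
      by eventually_elim (auto simp: r_comp_def)
  qed
  then have 2: "\<forall>\<^sub>F p in at_top. norm (infdist (I_point k p) (r_comp a i k)) \<le> norm (I_point k p - ?R p)"
    by eventually_elim (simp add: infdist_le infdist_nonneg flip: dist_norm)
  show ?thesis
    by (rule Lim_null_comparison[OF 2 tendsto_norm_zero[OF 1]])
qed

section \<open>Equilibria\<close>

text \<open>
  The \<open>\<lambda>\<close> are the principal Ricci curvatures up to a common positive factor, and the flow measures
  how far they are from being equal; this is why equilibria are the Einstein metrics.
\<close>

lemma f_mult_eq_lam: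
  assumes ix: "{i, j, k} = UNIV" and x: "x \<in> metrics"
  shows "f a x $ i * (x $ j * x $ k) = lam a j x + lam a k x - 2 * lam a i x"
proof -
  have ix2: "{j, i, k} = UNIV" "{k, i, j} = UNIV"
    using ix by auto
  have "x $ j > 0" "x $ k > 0"
    using x metrics_iff[OF ix] by auto
  then show ?thesis
    unfolding f_eq[OF ix] lam_eq[OF ix] lam_eq[OF ix2(1)] lam_eq[OF ix2(2)]
    by (simp add: field_simps power2_eq_square)
qed

lemma equilibrium_iff:
  assumes ix: "{i, j, k} = UNIV" and x: "x \<in> metrics"
  shows "equilibrium a x \<longleftrightarrow> lam a i x = lam a j x \<and> lam a j x = lam a k x"
proof -
  have ix2: "{j, i, k} = UNIV" "{k, i, j} = UNIV"
    using ix by auto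
  have pos: "x $ i \<noteq> 0" "x $ j \<noteq> 0" "x $ k \<noteq> 0"
    using x metrics_iff[OF ix] by auto
  have "equilibrium a x \<longleftrightarrow> f a x $ i * (x $ j * x $ k) = 0 \<and> f a x $ j * (x $ i * x $ k) = 0
      \<and> f a x $ k * (x $ i * x $ j) = 0"
    unfolding equilibrium_def vec3_eq[OF ix] using x pos by simp
  then show ?thesis
    unfolding f_mult_eq_lam[OF ix x] f_mult_eq_lam[OF ix2(1) x] f_mult_eq_lam[OF ix2(2) x] by auto
qed

lemma lam_diff:
  assumes ix: "{i, j, k} = UNIV"
  shows "lam a i x - lam a j x = (x $ i - x $ j) * (2 * a * (x $ i + x $ j) - x $ k)"
proof -
  have ix2: "{j, i, k} = UNIV"
    using ix by auto
  show ?thesis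
    unfolding lam_eq[OF ix] lam_eq[OF ix2] by (simp add: algebra_simps power2_eq_square)
qed

text \<open>
  With \<open>x\<^sub>i = x\<^sub>j\<close> there are the two solutions \<open>x\<^sub>k = x\<^sub>j\<close>, where \<open>\<lambda>\<^sub>i = (1 - a) x\<^sub>k\<^sup>2\<close>,
  and \<open>2 a (x\<^sub>j + x\<^sub>k) = x\<^sub>j\<close>, where \<open>\<lambda>\<^sub>i = (1/2 + a) x\<^sub>j x\<^sub>k\<close>.
\<close>

lemma equilibrium_ricci_pos_if_eq:
  assumes a: "0 < a" "a < 1/2" and ix: "{i, j, k} = UNIV"
    and x: "x \<in> metrics" and eq: "lam a i x = lam a j x" "lam a j x = lam a k x" and xij: "x $ i = x $ j"
  shows "lam a i x > 0"
proof -
  have ix2: "{j, k, i} = UNIV"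
    using ix by auto
  have pos: "x $ j > 0" "x $ k > 0"
    using x metrics_iff[OF ix] by auto
  show ?thesis
  proof (cases "x $ j = x $ k")
    case True
    have "lam a i x = (1 - a) * (x $ k)\<^sup>2"
      unfolding lam_eq[OF ix] xij True by (simp add: algebra_simps power2_eq_square)
    then show ?thesis using a pos by simp
  next
    case False
    then have "2 * a * (x $ j + x $ k) = x $ j"
      using lam_diff[OF ix2, of a x] eq(2) xij by simp
    moreover have "2 * a * (x $ j + x $ k) = 2 * (a * x $ j) + 2 * (a * x $ k)"
      by (simp add: algebra_simps)
    moreover have "x $ j * (1/2 + a) = x $ j / 2 + a * x $ j"
      by (simp add: algebra_simps)
    ultimately have "x $ j - a * x $ k = x $ j * (1/2 + a)"
      by linarith
    moreover have "lam a i x = x $ k * (x $ j - a * x $ k)"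
      unfolding lam_eq[OF ix] xij by (simp add: algebra_simps power2_eq_square)
    ultimately have "lam a i x = x $ k * (x $ j * (1/2 + a))"
      by (simp only:)
    then show ?thesis using a pos by simp
  qed
qed

text \<open>
  If all coordinates were distinct, the second factors of \<open>lam_diff\<close> would give \<open>x\<^sub>3 = 2 a (x\<^sub>1 + x\<^sub>2)\<close> and
  \<open>x\<^sub>1 = 2 a (x\<^sub>2 + x\<^sub>3)\<close>, whose difference is \<open>(1 + 2 a) (x\<^sub>1 - x\<^sub>3) = 0\<close>.
\<close>

lemma equilibrium_in_unit_ricci_pos:
  assumes a: "0 < a" "a < 1/2" and x: "x \<in> unit_vol" and e: "equilibrium a x"
  shows "x \<in> unit_ricci_pos a"
proof -
  have ix: "{1, 2, 3} = (UNIV::3 set)" "{2, 3, 1} = (UNIV::3 set)" "{1, 3, 2} = (UNIV::3 set)"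
    unfolding UNIV_3 by blast+
  have m: "x \<in> metrics"
    using x by (rule unit_vol_metrics)
  have eq: "lam a 1 x = lam a 2 x" "lam a 2 x = lam a 3 x"
    using e equilibrium_iff[OF ix(1) m] by auto
  have pos: "x $ 1 > 0" "x $ 2 > 0" "x $ 3 > 0"
    using m metrics_iff[OF ix(1)] by auto
  have "x $ 1 = x $ 2 \<or> x $ 2 = x $ 3 \<or> x $ 1 = x $ 3"
  proof (rule ccontr)
    assume "\<not> ?thesis"
    then have ne: "x $ 1 \<noteq> x $ 2" "x $ 2 \<noteq> x $ 3" "x $ 1 \<noteq> x $ 3"
      by simp_all
    have "(x $ 1 - x $ 2) * (2 * a * (x $ 1 + x $ 2) - x $ 3) = 0"
      "(x $ 2 - x $ 3) * (2 * a * (x $ 2 + x $ 3) - x $ 1) = 0"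
      unfolding lam_diff[OF ix(1), symmetric] lam_diff[OF ix(2), symmetric] using eq by simp_all
    then have "2 * a * (x $ 1 + x $ 2) = x $ 3" "2 * a * (x $ 2 + x $ 3) = x $ 1"
      using ne by simp_all
    moreover have "(1 + 2 * a) * (x $ 1 - x $ 3)
        = (x $ 1 - 2 * a * (x $ 2 + x $ 3)) - (x $ 3 - 2 * a * (x $ 1 + x $ 2))"
      by (simp add: algebra_simps)
    ultimately have "(1 + 2 * a) * (x $ 1 - x $ 3) = 0"
      by linarith
    with a ne(3) show False by simp
  qed
  then have "lam a 1 x > 0"
  proof (elim disjE)
    assume "x $ 1 = x $ 2"
    then show ?thesis
      by (rule equilibrium_ricci_pos_if_eq[OF a ix(1) m eq])
  next
    assume "x $ 2 = x $ 3"
    then show ?thesis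
      using equilibrium_ricci_pos_if_eq[OF a ix(2) m eq(2)] eq by (metis)
  next
    assume "x $ 1 = x $ 3"
    then show ?thesis
      by (rule equilibrium_ricci_pos_if_eq[OF a ix(3) m trans[OF eq] eq(2)[symmetric]])
  qed
  then show ?thesis
    unfolding unit_ricci_pos_iff all_index3[OF ix(1), of "\<lambda>m. 0 < lam a m x"]
    using x eq by auto
qed

lemma f_unit_vol:
  assumes ix: "{i, j, k} = UNIV" and x: "x \<in> unit_vol"
  shows "f a x $ i = x $ i * (lam a j x + lam a k x - 2 * lam a i x)"
proof -
  have "x $ i * x $ j * x $ k = 1"
    using x unfolding unit_vol_iff[OF ix] by blast
  then have "f a x $ i = x $ i * (f a x $ i * (x $ j * x $ k))"
    by (simp add: algebra_simps)
  then show ?thesis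
    unfolding f_mult_eq_lam[OF ix unit_vol_metrics[OF x]] .
qed

section \<open>Invariance of unit volume and of the Kaehler curves\<close>

text \<open>
  Uniqueness for a homogeneous linear equation: dividing by the exponential of a primitive of \<open>c\<close>
  turns \<open>g\<close> into a constant.
\<close>

lemma linear_ode_zero:
  fixes g c :: "real \<Rightarrow> real"
  assumes J: "is_interval J" and t: "t0 \<in> J" "t \<in> J" and 0: "g t0 = 0"
    and g: "\<And>t. t \<in> J \<Longrightarrow> (g has_real_derivative c t * g t) (at t)" and c: "continuous_on J c"
  shows "g t = 0"
proof -
  define S where "S = {min t0 t..max t0 t}"
  have S: "S \<subseteq> J"
  proof
    fix s assume "s \<in> S"
    then have "t0 \<le> s \<and> s \<le> t \<or> t \<le> s \<and> s \<le> t0"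
      unfolding S_def by auto
    then show "s \<in> J"
      using mem_is_interval_1_I[OF J] t by blast
  qed
  obtain C where C: "\<And>s. s \<in> S \<Longrightarrow> (C has_real_derivative c s) (at s within S)"
    using antiderivative_continuous[OF continuous_on_subset[OF c S, unfolded S_def]]
    unfolding S_def has_real_derivative_iff_has_vector_derivative by blast
  have "((\<lambda>s. g s * exp (- C s)) has_real_derivative 0) (at s within S)" if "s \<in> S" for s
    using that S by (auto intro!: derivative_eq_intros C has_field_derivative_at_within[OF g])
  then obtain d where d: "\<And>s. s \<in> S \<Longrightarrow> g s * exp (- C s) = d"
    using has_field_derivative_zero_constant[of S "\<lambda>s. g s * exp (- C s)"] S_def by auto
  have "t0 \<in> S" "t \<in> S"
    by (auto simp: S_def)
  then show ?thesis
    using d[of t0] d[of t] 0 by simp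
qed

lemma solutionD:
  assumes "solution a J x" "t \<in> J"
  shows "x t \<in> metrics" "((\<lambda>t. x t $ m) has_real_derivative f a (x t) $ m) (at t)"
  using assms has_vector_derivative_nth unfolding solution_def by blast+

lemma solution_continuous_on:
  assumes "solution a J x"
  shows "continuous_on J x"
  using assms unfolding solution_def
  by (meson continuous_at_imp_continuous_on has_vector_derivative_continuous)

text \<open>
  The derivative of \<open>x\<^sub>1 x\<^sub>2 x\<^sub>3\<close> is the sum of the terms \<open>f\<^sub>i x\<^sub>j x\<^sub>k = \<lambda>\<^sub>j + \<lambda>\<^sub>k - 2 \<lambda>\<^sub>i\<close>, which cancel.
\<close>

lemma invariant_unit_vol: "invariant_set a unit_vol"
  unfolding invariant_set_def
proof (intro allI impI subsetI, elim conjE bexE imageE)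
  fix J x t0 y t
  assume sol: "solution a J x" and t0: "t0 \<in> J" "x t0 \<in> unit_vol" and t: "y = x t" "t \<in> J"
  have ix: "{1, 2, 3} = (UNIV :: 3 set)" "{2, 3, 1} = (UNIV :: 3 set)" "{3, 1, 2} = (UNIV :: 3 set)"
    unfolding UNIV_3 by blast+
  (* Normalized to vanish at time t0, so that the linear equation with zero coefficient applies. *)
  define V where "V s = x s $ 1 * x s $ 2 * x s $ 3 - 1" for s
  have "(V has_real_derivative 0 * V s) (at s)" if s: "s \<in> J" for s
  proof -
    have "(V has_real_derivative f a (x s) $ 1 * (x s $ 2 * x s $ 3) + f a (x s) $ 2 * (x s $ 3 * x s $ 1)
        + f a (x s) $ 3 * (x s $ 1 * x s $ 2)) (at s)"
      unfolding V_def by (auto intro!: derivative_eq_intros solutionD(2)[OF sol s] simp: algebra_simps)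
    then show ?thesis
      unfolding f_mult_eq_lam[OF ix(1) solutionD(1)[OF sol s]] f_mult_eq_lam[OF ix(2) solutionD(1)[OF sol s]]
        f_mult_eq_lam[OF ix(3) solutionD(1)[OF sol s]] by simp
  qed
  moreover have "V t0 = 0"
    using t0 by (simp add: V_def unit_vol_def)
  moreover have "is_interval J"
    using sol by (simp add: solution_def)
  ultimately have "V t = 0"
    using linear_ode_zero[of J t0 t V "\<lambda>_. 0"] t0 t by simp
  then show "y \<in> unit_vol"
    using solutionD(1)[OF sol t(2)] t by (simp add: V_def unit_vol_def)
qed

text \<open>
  For \<open>a = 1/6\<close> and unit volume, \<open>f\<^sub>k - f\<^sub>i - f\<^sub>j\<close> is divisible by \<open>x\<^sub>k - x\<^sub>i - x\<^sub>j\<close>.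
\<close>

lemma invariant_l_curve:
  assumes ix: "{i, j, k} = UNIV"
  shows "invariant_set (1/6) (l_curve k)"
  unfolding invariant_set_def
proof (intro allI impI subsetI, elim conjE bexE imageE)
  fix J x t0 y t
  assume sol: "solution (1/6) J x" and t0: "t0 \<in> J" "x t0 \<in> l_curve k" and t: "y = x t" "t \<in> J"
  have ix2: "{j, i, k} = UNIV" "{k, i, j} = UNIV"
    using ix by auto
  have v: "x s \<in> unit_vol" if "s \<in> J" for s
    using invariant_unit_vol[of "1/6"] sol t0 that unfolding invariant_set_def l_curve_eq[OF ix] by blast
  define g where "g s = x s $ k - x s $ i - x s $ j" for s
  define c where "c s = - (2/3) * ((x s $ i)\<^sup>2 + (x s $ j)\<^sup>2 + (x s $ k)\<^sup>2 - 3 * (x s $ i * x s $ j))" for s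
  have "(g has_real_derivative c s * g s) (at s)" if s: "s \<in> J" for s
  proof -
    have "(g has_real_derivative f (1/6) (x s) $ k - f (1/6) (x s) $ i - f (1/6) (x s) $ j) (at s)"
      unfolding g_def by (intro derivative_intros solutionD(2)[OF sol s])
    also have "f (1/6) (x s) $ k - f (1/6) (x s) $ i - f (1/6) (x s) $ j = c s * g s"
      unfolding f_unit_vol[OF ix v[OF s]] f_unit_vol[OF ix2(1) v[OF s]] f_unit_vol[OF ix2(2) v[OF s]]
        c_def g_def lam_eq[OF ix] lam_eq[OF ix2(1)] lam_eq[OF ix2(2)]
      by (simp add: field_simps power2_eq_square)
    finally show ?thesis .
  qed
  moreover have "continuous_on J c"
    unfolding c_def by (intro continuous_intros solution_continuous_on[OF sol])
  moreover have "g t0 = 0"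
    using t0(2) unfolding l_curve_eq[OF ix] by (simp add: g_def)
  moreover have "is_interval J"
    using sol by (simp add: solution_def)
  ultimately have "g t = 0"
    using linear_ode_zero[of J t0 t g c] t0 t by blast
  then show "y \<in> l_curve k"
    unfolding l_curve_eq[OF ix] using v t by (simp add: g_def)
qed

text \<open>
  On \<open>l\<^sub>k\<close> the \<open>\<lambda>\<close> are monomials: \<open>\<lambda>\<^sub>i = (2/3) x\<^sub>j x\<^sub>k\<close>, \<open>\<lambda>\<^sub>j = (2/3) x\<^sub>i x\<^sub>k\<close> and
  \<open>\<lambda>\<^sub>k = (4/3) x\<^sub>i x\<^sub>j\<close>.
\<close>

lemma f_l_curve:
  assumes ix: "{i, j, k} = UNIV" and x: "x \<in> l_curve k"
  shows "f (1/6) x $ i = (2/3) * x $ i * (x $ i - x $ j) * (x $ i + 2 * x $ j)"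
    "f (1/6) x $ j = (2/3) * x $ j * (x $ j - x $ i) * (x $ j + 2 * x $ i)"
    "f (1/6) x $ k = (2/3) * x $ k * (x $ i - x $ j)\<^sup>2"
proof -
  have ix2: "{j, i, k} = UNIV" "{k, i, j} = UNIV"
    using ix by auto
  have v: "x \<in> unit_vol" and k: "x $ k = x $ i + x $ j"
    using x unfolding l_curve_eq[OF ix] by auto
  note * = f_unit_vol[OF ix v] f_unit_vol[OF ix2(1) v] f_unit_vol[OF ix2(2) v]
    lam_eq[OF ix] lam_eq[OF ix2(1)] lam_eq[OF ix2(2)] k
  show "f (1/6) x $ i = (2/3) * x $ i * (x $ i - x $ j) * (x $ i + 2 * x $ j)"
    "f (1/6) x $ j = (2/3) * x $ j * (x $ j - x $ i) * (x $ j + 2 * x $ i)"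
    "f (1/6) x $ k = (2/3) * x $ k * (x $ i - x $ j)\<^sup>2"
    unfolding * by (simp_all add: field_simps power2_eq_square)
qed

section \<open>Parameterization of the Kaehler curves\<close>

lemma regular_open_curve_l:
  assumes ix: "{k, i, j} = UNIV"
  shows "regular_open_curve (l_param k i ` {0<..})"
proof -
  have "regular_param (l_param k i) {0<..}"
    unfolding l_param_eq
  proof (rule regular_param_ratio_point[OF ix])
    let ?P = "\<lambda>t::real. t\<^sup>2 + t"
    let ?b' = "\<lambda>t::real. (- 1 / 3) * ?P t powr (- 1 / 3 - 1) * (2 * t + 1)"
    have P: "?P t > 0" if "t \<in> {0<..}" for t
      using that by (simp add: add_pos_pos)
    then show "phi t > 0" if "t \<in> {0<..}" for t
      using that unfolding phi_def by (metis less_irrefl powr_gt_zero)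
    show "(phi has_real_derivative ?b' t) (at t within {0<..})" if "t \<in> {0<..}" for t
    proof -
      have "(?P has_real_derivative 2 * t + 1) (at t within {0<..})"
        by (auto intro!: derivative_eq_intros)
      then show ?thesis
        unfolding phi_def by (intro has_real_derivative_powr_within P that)
    qed
    show "continuous_on {0<..} ?b'"
      by (intro continuous_intros) (use P in \<open>auto simp: less_imp_neq[THEN not_sym]\<close>)
  qed auto
  moreover have "inj_on (l_param k i) {0<..}"
  proof (rule inj_on_inverseI[where g = "\<lambda>x. x $ i / x $ j"])
    fix t :: real assume "t \<in> {0<..}"
    then have "phi t \<noteq> 0"
      unfolding phi_def by (simp add: add_pos_pos less_imp_neq[THEN not_sym])
    then show "l_param k i t $ i / l_param k i t $ j = t"
      unfolding l_param_eq ratio_point_nth[OF ix] by simp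
  qed
  ultimately show ?thesis
    unfolding regular_open_curve_def
    by (intro exI[of _ "l_param k i"] exI[of _ "{0::real<..}"]) (auto simp: is_interval_1)
qed

text \<open>
  With \<open>x\<^sub>i = t x\<^sub>j\<close> and \<open>x\<^sub>k = (t + 1) x\<^sub>j\<close> the volume is \<open>x\<^sub>j\<^sup>3 (t\<^sup>2 + t)\<close>, so \<open>x\<^sub>j = \<phi>(t)\<close>.
\<close>

lemma l_curve_eq_l_param:
  assumes ix: "{k, i, j} = UNIV"
  shows "l_curve k = l_param k i ` {0<..}"
proof -
  have ix2: "{i, j, k} = UNIV"
    using ix by auto
  have phi: "b = phi t \<longleftrightarrow> b ^ 3 * (t\<^sup>2 + t) = 1" if "b > 0" "t > 0" for b t
    using power_mult_eq_1_iff[of b "t\<^sup>2 + t" 3] that by (simp add: phi_def add_pos_pos)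
  show ?thesis
  proof (intro set_eqI iffI)
    fix x assume "x \<in> l_curve k"
    then have v: "x \<in> unit_vol" and k: "x $ k = x $ i + x $ j"
      unfolding l_curve_eq[OF ix2] by auto
    then have pos: "x $ i > 0" "x $ j > 0" and vol: "x $ k * x $ i * x $ j = 1"
      unfolding unit_vol_iff[OF ix] by auto
    define t where "t = x $ i / x $ j"
    have t: "t > 0" "x $ i = t * x $ j"
      using pos by (auto simp: t_def)
    have "(x $ j) ^ 3 * (t\<^sup>2 + t) = 1"
      using vol unfolding k t(2) by (simp add: algebra_simps power2_eq_square power3_eq_cube)
    then have "phi t = x $ j"
      using phi[OF pos(2) t(1)] by simp
    then have "x = l_param k i t"
      unfolding l_param_eq t_def by (rule unit_vol_eq_ratio_point[OF ix v])
    with t show "x \<in> l_param k i ` {0<..}" by simp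
  next
    fix x assume "x \<in> l_param k i ` {0<..}"
    then obtain t where t: "t > 0" and x: "x = ratio_point k i phi t"
      unfolding l_param_eq by auto
    have b: "phi t > 0"
      using t unfolding phi_def by (simp add: add_pos_pos less_imp_neq[THEN not_sym])
    have "phi t ^ 3 * (t\<^sup>2 + t) = 1"
      using phi[OF b t] by simp
    then have "1 / (t * (phi t)\<^sup>2) = t * phi t + phi t"
      using b t by (simp add: field_simps power2_eq_square power3_eq_cube)
    then show "x \<in> l_curve k"
      unfolding l_curve_eq[OF ix2] using ratio_point_unit_vol[OF ix t, of phi] b
      by (simp add: x ratio_point_nth[OF ix])
  qed
qed

section \<open>Autonomous scalar equations and the Kaehler flow\<close>

text \<open>
  Separation of variables: a primitive \<open>H\<close> of \<open>1/h\<close> measures the time needed to reach \<open>v\<close>, and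
  its inverse solves \<open>u' = h(u)\<close>. The limit of \<open>H\<close> at \<open>c\<close> says that \<open>c\<close> is reached only in the
  infinite past; the finite limit at infinity is the blow-up time.
\<close>

lemma scalar_flow_from_primitive:
  fixes H h :: "real \<Rightarrow> real" and c T :: real
  assumes deriv: "\<And>v. v > c \<Longrightarrow> (H has_real_derivative 1 / h v) (at v)"
    and h: "\<And>v. v > c \<Longrightarrow> h v > 0"
    and lo: "filterlim H at_bot (at_right c)" and hi: "(H \<longlongrightarrow> T) at_top"
  obtains u where "\<And>\<tau>. \<tau> < T \<Longrightarrow> u \<tau> > c" "\<And>\<tau>. \<tau> < T \<Longrightarrow> (u has_real_derivative h (u \<tau>)) (at \<tau>)"
    "(u \<longlongrightarrow> c) at_bot" "filterlim u at_top (at_left T)" "\<And>v. v > c \<Longrightarrow> \<exists>\<tau><T. u \<tau> = v"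
proof -
  have mono: "H v < H w" if "c < v" "v < w" for v w
    using that deriv h by (intro DERIV_pos_imp_increasing[of v w H]) (meson less_le_trans divide_pos_pos zero_less_one)+
  have less_iff: "H v < H w \<longleftrightarrow> v < w" if "c < v" "c < w" for v w
    using mono[of v w] mono[of w v] that by (metis less_asym less_irrefl neqE)
  have below: "H v < T" if v: "c < v" for v
  proof -
    (* Comparing with the value at a later point keeps the inequality strict. *)
    have "H (v + 1) \<le> T"
    proof (rule tendsto_lowerbound[OF hi])
      show "\<forall>\<^sub>F w in at_top. H (v + 1) \<le> H w"
        using eventually_gt_at_top[of "v + 1"] by eventually_elim (use mono v in \<open>simp add: less_imp_le\<close>)
    qed simp
    with mono[of v "v + 1"] v show ?thesis by simp
  qed
  have surj: "\<exists>v>c. H v = \<tau>" if \<tau>: "\<tau> < T" for \<tau>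
  proof -
    have "\<forall>\<^sub>F v in at_right c. H v \<le> \<tau>"
      using lo by (simp add: filterlim_at_bot)
    then have "\<forall>\<^sub>F v in at_right c. H v \<le> \<tau> \<and> v > c"
      by (rule eventually_conj) (simp add: eventually_at_filter)
    then obtain v1 where v1: "H v1 \<le> \<tau>" "v1 > c"
      by (metis (no_types, lifting) eventually_happens trivial_limit_at_right_real)
    have "\<forall>\<^sub>F v in at_top. H v > \<tau> \<and> v > v1"
      by (intro eventually_conj order_tendstoD(1)[OF hi \<tau>] eventually_gt_at_top)
    then obtain v2 where v2: "H v2 > \<tau>" "v2 > v1"
      by (metis (no_types, lifting) eventually_happens trivial_limit_at_top_linorder)
    have "\<exists>v. v1 \<le> v \<and> v \<le> v2 \<and> H v = \<tau>"
    proof (rule IVT)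
      show "\<forall>v. v1 \<le> v \<and> v \<le> v2 \<longrightarrow> isCont H v"
        using v1(2) deriv by (meson DERIV_isCont less_le_trans)
    qed (use v1 v2 in auto)
    then obtain v where "v1 \<le> v" "H v = \<tau>"
      by blast
    with v1(2) show ?thesis
      by (intro exI[of _ v]) auto
  qed
  define u where "u \<tau> = (SOME v. v > c \<and> H v = \<tau>)" for \<tau>
  have u: "u \<tau> > c" "H (u \<tau>) = \<tau>" if "\<tau> < T" for \<tau>
    using someI_ex[of "\<lambda>v. v > c \<and> H v = \<tau>"] surj[OF that] unfolding u_def by auto
  have uH: "u (H v) = v" if "v > c" for v
    using u[OF below[OF that]] less_iff that by (metis less_irrefl neqE)
  have u_less: "u \<tau> < v \<longleftrightarrow> \<tau> < H v" if "\<tau> < T" "v > c" for \<tau> v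
    using less_iff[OF u(1)[OF that(1)] that(2)] u(2)[OF that(1)] by simp
  have u_gr: "v < u \<tau> \<longleftrightarrow> H v < \<tau>" if "\<tau> < T" "v > c" for \<tau> v
    using less_iff[OF that(2) u(1)[OF that(1)]] u(2)[OF that(1)] by simp
  have isc: "isCont u \<tau>" if \<tau>: "\<tau> < T" for \<tau>
  proof -
    define v where "v = u \<tau>"
    have v: "v > c" "H v = \<tau>"
      using u[OF \<tau>] by (auto simp: v_def)
    have "isCont u (H v)"
    proof (rule isCont_inverse_function2[of "(c + v) / 2" v "v + 1"])
      show "(c + v) / 2 < v" "v < v + 1" using v by auto
      fix z assume "(c + v) / 2 \<le> z" "z \<le> v + 1"
      then have "z > c" using v by (auto simp: field_simps)
      then show "u (H z) = z" "isCont H z"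
        using uH deriv DERIV_isCont by blast+
    qed
    with v show ?thesis by simp
  qed
  show ?thesis
  proof
    show "u \<tau> > c" if "\<tau> < T" for \<tau>
      by (rule u(1)[OF that])
    show "\<exists>\<tau><T. u \<tau> = v" if "v > c" for v
      using uH[OF that] below[OF that] by blast
    show "(u has_real_derivative h (u \<tau>)) (at \<tau>)" if \<tau>: "\<tau> < T" for \<tau>
    proof -
      have "(u has_real_derivative inverse (1 / h (u \<tau>))) (at \<tau>)"
      proof (rule DERIV_inverse_function[where f = H and a = "\<tau> - 1" and b = T])
        show "1 / h (u \<tau>) \<noteq> 0"
          using h[OF u(1)[OF \<tau>]] by simp
      qed (use \<tau> u isc deriv in auto)
      then show ?thesis by simp
    qed
    show "(u \<longlongrightarrow> c) at_bot"
    proof (rule order_tendstoI)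
      fix d assume d: "d < c"
      show "\<forall>\<^sub>F \<tau> in at_bot. d < u \<tau>"
        using eventually_gt_at_bot[of T] by eventually_elim (use u(1) d in \<open>blast intro: less_trans\<close>)
    next
      fix d assume d: "c < d"
      have "\<forall>\<^sub>F \<tau> in at_bot. \<tau> < H d"
        by (rule eventually_gt_at_bot)
      then show "\<forall>\<^sub>F \<tau> in at_bot. u \<tau> < d"
        using eventually_gt_at_bot[of T] by eventually_elim (use u_less d in blast)
    qed
    show "filterlim u at_top (at_left T)"
      unfolding filterlim_at_top_gt[where c = c]
    proof (intro allI impI)
      fix d assume d: "c < d"
      have "\<forall>\<^sub>F \<tau> in at_left T. \<tau> \<in> {H d<..<T}"
        by (rule eventually_at_leftI[OF _ below[OF d]])
      then show "\<forall>\<^sub>F \<tau> in at_left T. d \<le> u \<tau>"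
        by eventually_elim (use u_gr d in \<open>auto intro: less_imp_le\<close>)
    qed
  qed
qed

text \<open>
  The primitive of \<open>3 / (w\<^sup>3 - 1)\<close> for \<open>w > 1\<close>, by partial fractions.
\<close>

definition cube_primitive where "cube_primitive w = ln (w - 1) - ln (w\<^sup>2 + w + 1) / 2 - sqrt 3 * arctan ((2 * w + 1) / sqrt 3)" for w :: real

lemma cube_primitive_deriv:
  assumes w: "w > 1"
  shows "(cube_primitive has_real_derivative 3 / (w ^ 3 - 1)) (at w)"
proof -
  have q: "w\<^sup>2 + w + 1 > 0"
    using w by (intro add_pos_pos) auto
  have "(cube_primitive has_real_derivative 1 / (w - 1) - (2 * w + 1) / (2 * (w\<^sup>2 + w + 1))
      - 2 / (1 + ((2 * w + 1) / sqrt 3)\<^sup>2)) (at w)"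
    unfolding cube_primitive_def
  proof (intro DERIV_diff)
    show "((\<lambda>w. ln (w - 1)) has_real_derivative 1 / (w - 1)) (at w)"
      using w by (auto intro!: derivative_eq_intros)
    show "((\<lambda>w. ln (w\<^sup>2 + w + 1) / 2) has_real_derivative (2 * w + 1) / (2 * (w\<^sup>2 + w + 1))) (at w)"
      using q by (auto intro!: derivative_eq_intros simp: divide_simps) (simp add: algebra_simps)
    have *: "sqrt 3 * (inverse X * (2 / sqrt 3)) = 2 / X" for X
      by (simp add: field_simps)
    have "((\<lambda>w. (2 * w + 1) / sqrt 3) has_real_derivative 2 / sqrt 3) (at w)"
      by (intro DERIV_cdivide) (auto intro!: derivative_eq_intros)
    then show "((\<lambda>w. sqrt 3 * arctan ((2 * w + 1) / sqrt 3)) has_real_derivative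
        2 / (1 + ((2 * w + 1) / sqrt 3)\<^sup>2)) (at w)"
      using DERIV_cmult[OF DERIV_chain2[OF DERIV_arctan], of "\<lambda>w. (2 * w + 1) / sqrt 3" "2 / sqrt 3" w UNIV "sqrt 3"]
      unfolding * by blast
  qed
  moreover have "2 / (1 + ((2 * w + 1) / sqrt 3)\<^sup>2) = 3 / (2 * (w\<^sup>2 + w + 1))"
  proof -
    have "1 + ((2 * w + 1) / sqrt 3)\<^sup>2 = (4 / 3) * (w\<^sup>2 + w + 1)"
      by (simp add: power_divide field_simps power2_eq_square)
    moreover have "2 / ((4 / 3) * X) = 3 / (2 * X)" for X :: real
      by simp
    ultimately show ?thesis by (simp only:)
  qed
  moreover have "1 / (w - 1) - (2 * w + 1) / (2 * (w\<^sup>2 + w + 1)) - 3 / (2 * (w\<^sup>2 + w + 1)) = 3 / (w ^ 3 - 1)"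
  proof -
    have "w ^ 3 - 1 = (w - 1) * (w\<^sup>2 + w + 1)"
      by (simp add: algebra_simps power2_eq_square power3_eq_cube)
    then show ?thesis
      using w q by (simp add: divide_simps) (simp add: algebra_simps power2_eq_square)
  qed
  ultimately show ?thesis by simp
qed

text \<open>
  The substitution \<open>v = c w\<close> reduces \<open>v\<^sup>3 - 4\<close> to \<open>4 (w\<^sup>3 - 1)\<close>.
\<close>

lemma kaehler_scalar_flow:
  fixes c :: real
  assumes c: "c > 0" "c ^ 3 = 4"
  obtains T u where "\<And>\<tau>. \<tau> < T \<Longrightarrow> u \<tau> > c"
    "\<And>\<tau>. \<tau> < T \<Longrightarrow> (u has_real_derivative (2/3) * ((u \<tau>) ^ 3 - 4)) (at \<tau>)"
    "(u \<longlongrightarrow> c) at_bot" "filterlim u at_top (at_left T)" "\<And>v. v > c \<Longrightarrow> \<exists>\<tau><T. u \<tau> = v"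
proof -
  let ?T = "- sqrt 3 * pi / 2 / (2 * c\<^sup>2)"
  let ?H = "\<lambda>v. cube_primitive (v / c) / (2 * c\<^sup>2)" and ?h = "\<lambda>v. (2/3) * (v ^ 3 - 4)"
  have pos: "v ^ 3 - 4 > 0" if "v > c" for v
    using power_strict_mono[OF that, of 3] c by simp
  have 1: "(?H has_real_derivative 1 / ?h v) (at v)" if v: "v > c" for v
  proof -
    have "v / c > 1"
      using v c by simp
    then have "((\<lambda>v. cube_primitive (v / c)) has_real_derivative 3 / ((v / c) ^ 3 - 1) * (1 / c)) (at v)"
      using c by (intro DERIV_chain2[OF cube_primitive_deriv]) (auto intro!: derivative_eq_intros)
    then have H: "(?H has_real_derivative 3 / ((v / c) ^ 3 - 1) * (1 / c) / (2 * c\<^sup>2)) (at v)"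
      by (rule DERIV_cdivide)
    have v3: "(v / c) ^ 3 - 1 = (v ^ 3 - 4) / 4"
      by (simp add: power_divide c(2) diff_divide_distrib)
    have eq: "6 / (X * 4) = 1 / ((2/3) * X)" for X :: real
      by simp
    (* The constant 1 / (2 c^2) in ?H is the one for which c^3 = 4 turns these factors into 1 / ?h v. *)
    have "3 / (X / 4) * (1 / c) / (2 * c\<^sup>2) = 6 / (X * c ^ 3)" for X
      using c(1) by (cases "X = 0") (simp_all add: field_simps power2_eq_square power3_eq_cube)
    then have "3 / ((v / c) ^ 3 - 1) * (1 / c) / (2 * c\<^sup>2) = 6 / ((v ^ 3 - 4) * c ^ 3)"
      unfolding v3 .
    then have "3 / ((v / c) ^ 3 - 1) * (1 / c) / (2 * c\<^sup>2) = 1 / ?h v"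
      using eq by (simp only: c(2))
    with H show ?thesis by (simp only:)
  qed
  have "filterlim cube_primitive at_bot (at_right 1)"
  proof (rule filterlim_at_bot_mono)
    show "filterlim (\<lambda>w::real. ln (w - 1)) at_bot (at_right 1)"
      by real_asymp
    have "\<forall>\<^sub>F w::real in at_right 1. w > 1"
      by (simp add: eventually_at_filter)
    then show "\<forall>\<^sub>F w in at_right 1. cube_primitive w \<le> ln (w - 1)"
    proof eventually_elim
      case (elim w)
      have "ln (w\<^sup>2 + w + 1) \<ge> 0" "sqrt 3 * arctan ((2 * w + 1) / sqrt 3) \<ge> 0"
        using elim by auto
      then show ?case
        unfolding cube_primitive_def by linarith
    qed
  qed
  moreover have "filterlim (\<lambda>v. v / c) (at_right 1) (at_right c)"
    using c by real_asymp
  ultimately have "filterlim (\<lambda>v. cube_primitive (v / c)) at_bot (at_right c)"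
    by (rule filterlim_compose)
  moreover have "1 / (2 * c\<^sup>2) > 0"
    using c by simp
  ultimately have "filterlim (\<lambda>v. (1 / (2 * c\<^sup>2)) * cube_primitive (v / c)) at_bot (at_right c)"
    by (intro filterlim_tendsto_pos_mult_at_bot[OF tendsto_const])
  then have 2: "filterlim ?H at_bot (at_right c)"
    by simp
  have "(cube_primitive \<longlongrightarrow> - sqrt 3 * pi / 2) at_top"
    unfolding cube_primitive_def by real_asymp (simp add: sqrt_def)
  moreover have "filterlim (\<lambda>v. v / c) at_top at_top"
    using c by real_asymp
  ultimately have "((\<lambda>v. cube_primitive (v / c)) \<longlongrightarrow> - sqrt 3 * pi / 2) at_top"
    by (rule filterlim_compose)
  then have 3: "(?H \<longlongrightarrow> ?T) at_top"
    using c by (intro tendsto_divide tendsto_const) auto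
  show ?thesis
  proof (rule scalar_flow_from_primitive[of c ?H ?h, OF 1 _ 2 3])
    show "?h v > 0" if "v > c" for v
      using pos[OF that] by simp
  next
    fix u assume u: "\<And>\<tau>. \<tau> < ?T \<Longrightarrow> u \<tau> > c"
      "\<And>\<tau>. \<tau> < ?T \<Longrightarrow> (u has_real_derivative ?h (u \<tau>)) (at \<tau>)"
      "(u \<longlongrightarrow> c) at_bot" "filterlim u at_top (at_left ?T)" "\<And>v. v > c \<Longrightarrow> \<exists>\<tau><?T. u \<tau> = v"
    show thesis
      by (rule that[OF u])
  qed
qed

section \<open>Orbits on the Kaehler curves\<close>

text \<open>
  Coordinates on the plane \<open>x\<^sub>k = x\<^sub>i + x\<^sub>j\<close>: \<open>u = x\<^sub>k\<close> and \<open>d = x\<^sub>i - x\<^sub>j\<close>. The map is linear in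
  \<open>(d, u)\<close>, so it also describes velocities of curves in this plane.
\<close>

definition kaehler_point :: "3 \<Rightarrow> 3 \<Rightarrow> real \<Rightarrow> real \<Rightarrow> real^3" where
  "kaehler_point i k d u = (\<chi> m. if m = k then u else if m = i then (u + d) / 2 else (u - d) / 2)"

lemma kaehler_point_nth:
  assumes "{i, j, k} = (UNIV :: 3 set)"
  shows "kaehler_point i k d u $ i = (u + d) / 2" "kaehler_point i k d u $ j = (u - d) / 2"
    "kaehler_point i k d u $ k = u"
  using index3_distinct[OF assms] by (auto simp: kaehler_point_def)

text \<open>
  Unit volume becomes \<open>(u\<^sup>2 - d\<^sup>2) u = 4\<close>; positivity of all coordinates is then automatic.
\<close>

lemma kaehler_point_l_curve_iff:
  assumes ix: "{i, j, k} = UNIV" and u: "u > 0"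
  shows "kaehler_point i k d u \<in> l_curve k \<longleftrightarrow> d\<^sup>2 = u\<^sup>2 - 4 / u"
proof -
  have "(u + d) / 2 * ((u - d) / 2) * u = 1 \<longleftrightarrow> d\<^sup>2 = u\<^sup>2 - 4 / u"
  proof -
    have "(u + d) / 2 * ((u - d) / 2) * u = (u\<^sup>2 - d\<^sup>2) * u / 4"
      by (simp add: algebra_simps power2_eq_square)
    moreover have "u\<^sup>2 - d\<^sup>2 = 4 / u \<longleftrightarrow> (u\<^sup>2 - d\<^sup>2) * u = 4"
      using u by (simp add: eq_divide_eq)
    ultimately show ?thesis by linarith
  qed
  moreover
  have "\<bar>d\<bar> < u" if "d\<^sup>2 = u\<^sup>2 - 4 / u"
  proof -
    have "d\<^sup>2 < u\<^sup>2" using that u by simp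
    then show ?thesis
      using power2_less_imp_less[of "\<bar>d\<bar>" u] u by simp
  qed
  then have "(u + d) / 2 > 0 \<and> (u - d) / 2 > 0" if "d\<^sup>2 = u\<^sup>2 - 4 / u"
    using that by fastforce
  moreover have "u = (u + d) / 2 + (u - d) / 2"
    by (simp add: field_simps)
  ultimately show ?thesis
    unfolding l_curve_eq[OF ix] mem_Collect_eq unit_vol_iff[OF ix] kaehler_point_nth[OF ix]
    using u by blast
qed

lemma l_curve_eq_kaehler_point:
  assumes ix: "{i, j, k} = UNIV" and x: "x \<in> l_curve k"
  shows "x = kaehler_point i k (x $ i - x $ j) (x $ k)"
  using x unfolding l_curve_eq[OF ix] vec3_eq[OF ix] kaehler_point_nth[OF ix] by auto

text \<open>
  In the coordinates \<open>(d, u)\<close> the flow on \<open>l\<^sub>k\<close> is \<open>u' = (2/3) (u\<^sup>3 - 4)\<close> and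
  \<open>d' = (2/3) (u\<^sup>2 + 2/u) d\<close>, so that \<open>u\<close> evolves autonomously.
\<close>

lemma f_kaehler_point:
  assumes ix: "{i, j, k} = UNIV" and u: "u > 0" and d: "d\<^sup>2 = u\<^sup>2 - 4 / u"
  shows "f (1/6) (kaehler_point i k d u) = kaehler_point i k ((2/3) * (u\<^sup>2 + 2 / u) * d) ((2/3) * (u ^ 3 - 4))"
proof -
  have l: "kaehler_point i k d u \<in> l_curve k"
    using kaehler_point_l_curve_iff[OF ix u] d by simp
  note fl = f_l_curve[OF ix l]
  have e: "u * d\<^sup>2 = u ^ 3 - 4" "3 * u\<^sup>2 - d\<^sup>2 = 2 * (u\<^sup>2 + 2 / u)"
    using u unfolding d by (simp_all add: field_simps power2_eq_square power3_eq_cube)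
  have *: "f (1/6) (kaehler_point i k d u) $ i = (1/6) * (2 * (u * d\<^sup>2) + d * (3 * u\<^sup>2 - d\<^sup>2))"
    "f (1/6) (kaehler_point i k d u) $ j = (1/6) * (2 * (u * d\<^sup>2) - d * (3 * u\<^sup>2 - d\<^sup>2))"
    "f (1/6) (kaehler_point i k d u) $ k = (2/3) * (u * d\<^sup>2)"
    unfolding fl kaehler_point_nth[OF ix] by (simp_all add: field_simps power2_eq_square)
  show ?thesis
    unfolding vec3_eq[OF ix] kaehler_point_nth[OF ix] * e by (simp add: algebra_simps)
qed

text \<open>
  The scalar solution \<open>u\<close> gives the orbit with \<open>d = s sqrt (u\<^sup>2 - 4/u)\<close>, where the sign \<open>s\<close> selects
  the half of \<open>l\<^sub>k\<close> containing \<open>y\<close>. The orbit cannot be continued beyond \<open>T\<close>, because \<open>x\<^sub>k = u\<close> is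
  unbounded there.
\<close>

lemma kaehler_orbit:
  assumes ix: "{i, j, k} = UNIV" and c: "c > 0" "c ^ 3 = 4"
    and y: "y \<in> l_curve k" "y $ i \<noteq> y $ j"
  shows "\<exists>J x. maximal_solution (1/6) J x \<and> y \<in> x ` J \<and> tends_in_time J x (kaehler_point i k 0 c)"
proof -
  obtain T u where u: "\<And>\<tau>. \<tau> < T \<Longrightarrow> u \<tau> > c"
    and du: "\<And>\<tau>. \<tau> < T \<Longrightarrow> (u has_real_derivative (2/3) * ((u \<tau>) ^ 3 - 4)) (at \<tau>)"
    and lo: "(u \<longlongrightarrow> c) at_bot" and hi: "filterlim u at_top (at_left T)"
    and surj: "\<And>v. v > c \<Longrightarrow> \<exists>\<tau><T. u \<tau> = v"
    using kaehler_scalar_flow[OF c] by metis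
  define s where "s = sgn (y $ i - y $ j)"
  have s: "s\<^sup>2 = 1"
    using y(2) by (simp add: s_def sgn_if power2_eq_square)
  define D where "D = (\<lambda>\<tau>. s * sqrt ((u \<tau>)\<^sup>2 - 4 / u \<tau>))"
  define x where "x = (\<lambda>\<tau>. kaehler_point i k (D \<tau>) (u \<tau>))"
  have pos: "v\<^sup>2 - 4 / v > 0" "v > 0" if "v > c" for v
  proof -
    show v: "v > 0" using that c by simp
    have "v ^ 3 > 4"
      using power_strict_mono[OF that, of 3] c by simp
    then show "v\<^sup>2 - 4 / v > 0"
      using v by (simp add: field_simps power2_eq_square power3_eq_cube)
  qed
  have D2: "(D \<tau>)\<^sup>2 = (u \<tau>)\<^sup>2 - 4 / u \<tau>" if "\<tau> < T" for \<tau>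
    using pos[OF u[OF that]] s by (simp add: D_def power_mult_distrib)
  have dD: "(D has_real_derivative (2/3) * ((u \<tau>)\<^sup>2 + 2 / u \<tau>) * D \<tau>) (at \<tau>)" if t: "\<tau> < T" for \<tau>
  proof -
    let ?u = "u \<tau>"
    note p = pos[OF u[OF t]]
    define r where "r = sqrt (?u\<^sup>2 - 4 / ?u)"
    have r: "r > 0" "r\<^sup>2 = ?u\<^sup>2 - 4 / ?u"
      using p by (auto simp: r_def)
    have "((\<lambda>\<tau>. (u \<tau>)\<^sup>2 - 4 / u \<tau>) has_real_derivative (2 * ?u + 4 / ?u\<^sup>2) * ((2/3) * (?u ^ 3 - 4))) (at \<tau>)"
      using p by (auto intro!: derivative_eq_intros du[OF t] simp: field_simps power2_eq_square)
    from DERIV_cmult[OF DERIV_chain2[OF DERIV_real_sqrt[OF p(1)] this], of s]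
    have "(D has_real_derivative s * (inverse r / 2 * ((2 * ?u + 4 / ?u\<^sup>2) * ((2/3) * (?u ^ 3 - 4))))) (at \<tau>)"
      unfolding D_def r_def .
    moreover have "?u ^ 3 - 4 = ?u * r\<^sup>2"
      unfolding r using p by (simp add: field_simps power2_eq_square power3_eq_cube)
    then have "inverse r / 2 * ((2 * ?u + 4 / ?u\<^sup>2) * ((2/3) * (?u ^ 3 - 4))) = (2/3) * (?u\<^sup>2 + 2 / ?u) * r"
      using p r(1) by (simp add: field_simps power2_eq_square)
    ultimately show ?thesis
      unfolding D_def r_def by (simp only: mult_ac)
  qed
  have sol: "solution (1/6) {..<T} x"
    unfolding solution_def
  proof (intro conjI ballI)
    fix \<tau> assume "\<tau> \<in> {..<T}"
    then have t: "\<tau> < T" by simp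
    note p = pos(2)[OF u[OF t]]
    have "x \<tau> \<in> l_curve k"
      unfolding x_def kaehler_point_l_curve_iff[OF ix p] by (rule D2[OF t])
    then show "x \<tau> \<in> metrics"
      unfolding l_curve_eq[OF ix] using unit_vol_metrics by blast
    show "(x has_vector_derivative f (1/6) (x \<tau>)) (at \<tau>)"
      unfolding x_def f_kaehler_point[OF ix p D2[OF t]]
    proof (rule has_vector_derivative_vecI)
      fix m
      show "((\<lambda>\<tau>. kaehler_point i k (D \<tau>) (u \<tau>) $ m) has_real_derivative
          kaehler_point i k ((2/3) * ((u \<tau>)\<^sup>2 + 2 / u \<tau>) * D \<tau>) ((2/3) * ((u \<tau>) ^ 3 - 4)) $ m) (at \<tau>)"
        unfolding kaehler_point_def
        by (cases "m = k"; cases "m = i")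
          (simp_all, (intro DERIV_cdivide DERIV_add DERIV_diff dD[OF t, simplified] du[OF t, simplified])+)
    qed
  qed auto
  have max: "maximal_solution (1/6) {..<T} x"
    unfolding maximal_solution_def
  proof (intro conjI sol allI impI, elim conjE)
    fix J' z assume z: "solution (1/6) J' z" and sub: "{..<T} \<subseteq> J'" and eq: "\<forall>t\<in>{..<T}. z t = x t"
    have "T \<notin> J'"
    proof
      assume T: "T \<in> J'"
      have "isCont (\<lambda>t. z t $ k) T"
        using solutionD(2)[OF z T] DERIV_isCont by blast
      then have "((\<lambda>t. z t $ k) \<longlongrightarrow> z T $ k) (at_left T)"
        by (simp add: isCont_def tendsto_within_subset filterlim_at_split)
      moreover have lt: "\<forall>\<^sub>F t in at_left T. t < T"
        by (simp add: eventually_at_filter)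
      then have "\<forall>\<^sub>F t in at_left T. z t $ k = u t"
        by eventually_elim (use eq in \<open>simp add: x_def kaehler_point_nth[OF ix]\<close>)
      ultimately have "(u \<longlongrightarrow> z T $ k) (at_left T)"
        by (rule Lim_transform_eventually)
      then show False
        using not_tendsto_and_filterlim_at_infinity[OF trivial_limit_at_left_real]
          filterlim_at_top_imp_at_infinity[OF hi] by blast
    qed
    have "is_interval J'"
      using z by (simp add: solution_def)
    have "t < T" if "t \<in> J'" for t
    proof (rule ccontr)
      assume "\<not> t < T"
      moreover have "T - 1 \<in> J'"
        using sub by auto
      ultimately have "T \<in> J'"
        using mem_is_interval_1_I[OF \<open>is_interval J'\<close> _ that, of "T - 1" T] by simp
      with \<open>T \<notin> J'\<close> show False ..
    qed
    with sub show "J' = {..<T}" by auto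
  qed
  have "y \<in> x ` {..<T}"
  proof -
    define d v where "d = y $ i - y $ j" and "v = y $ k"
    have yk: "y = kaehler_point i k d v"
      unfolding d_def v_def by (rule l_curve_eq_kaehler_point[OF ix y(1)])
    have v: "v > 0"
      using y(1) unfolding l_curve_eq[OF ix] unit_vol_iff[OF ix] v_def by simp
    have d2: "d\<^sup>2 = v\<^sup>2 - 4 / v"
      using y(1) kaehler_point_l_curve_iff[OF ix v] yk by simp
    have "d\<^sup>2 > 0"
      using y(2) by (simp add: d_def)
    then have "c ^ 3 < v ^ 3"
      unfolding d2 c(2) using v by (simp add: field_simps power2_eq_square power3_eq_cube)
    then have "c < v"
      using power_less_imp_less_base[of c 3 v] v by simp
    then obtain \<tau> where \<tau>: "\<tau> < T" "u \<tau> = v"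
      using surj by blast
    have "D \<tau> = s * \<bar>d\<bar>"
      unfolding D_def \<tau>(2) d2[symmetric] by simp
    also have "\<dots> = d"
      by (simp add: s_def d_def sgn_mult_abs)
    finally show ?thesis
      using \<tau> yk by (auto simp: x_def)
  qed
  moreover have "(x \<longlongrightarrow> kaehler_point i k 0 c) at_bot"
  proof -
    have "c\<^sup>2 - 4 / c = 0"
      using c by (simp add: field_simps power2_eq_square power3_eq_cube)
    moreover have "(D \<longlongrightarrow> s * sqrt (c\<^sup>2 - 4 / c)) at_bot"
      unfolding D_def using c by (intro tendsto_intros lo) auto
    ultimately have D0: "(D \<longlongrightarrow> 0) at_bot" by simp
    show ?thesis
    proof (rule vec_tendstoI)
      fix m
      show "((\<lambda>\<tau>. x \<tau> $ m) \<longlongrightarrow> kaehler_point i k 0 c $ m) at_bot"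
        unfolding x_def kaehler_point_def
        using lo tendsto_divide[OF tendsto_add[OF lo D0] tendsto_const[of 2]]
          tendsto_divide[OF tendsto_diff[OF lo D0] tendsto_const[of 2]]
        by simp
    qed
  qed
  then have "tends_in_time {..<T} x (kaehler_point i k 0 c)"
    unfolding tends_in_time_def by (auto intro!: exI[of _ "T - 1"])
  ultimately show ?thesis
    using max by blast
qed

section \<open>The saddle and its separatrix\<close>

text \<open>
  The derivative of \<open>f\<close>, but only at equilibria: writing \<open>f\<^sub>i = N/M - 2\<close> with \<open>M = x\<^sub>j x\<^sub>k\<close>, the relation
  \<open>N = 2 M\<close> at an equilibrium simplifies the quotient rule to \<open>(N' - 2 M') / M\<close>.
\<close>

definition flow_linearization :: "real \<Rightarrow> real^3 \<Rightarrow> real^3 \<Rightarrow> real^3" where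
  "flow_linearization a z v = (\<chi> i. let j = i + 1; k = i + 2 in
     (v $ i * (z $ j + z $ k) + z $ i * (v $ j + v $ k)
      + 4 * a * (z $ j * v $ j + z $ k * v $ k - 2 * (z $ i * v $ i))
      - 2 * (v $ j * z $ k + z $ j * v $ k)) / (z $ j * z $ k))"

lemma flow_linearization_nth:
  assumes ix: "{i, j, k} = (UNIV :: 3 set)"
  shows "flow_linearization a z v $ i = (v $ i * (z $ j + z $ k) + z $ i * (v $ j + v $ k)
      + 4 * a * (z $ j * v $ j + z $ k * v $ k - 2 * (z $ i * v $ i))
      - 2 * (v $ j * z $ k + z $ j * v $ k)) / (z $ j * z $ k)"
  using index3_cases[OF ix] by (auto simp: flow_linearization_def Let_def algebra_simps)

lemma open_metrics: "open metrics"
proof -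
  have "metrics = (\<Inter>m. {x. x $ m > 0})"
    by (auto simp: metrics_def)
  moreover have "open (\<Inter>m. {x::real^3. x $ m > 0})"
    by (intro open_INT finite ballI open_Collect_less continuous_intros)
  ultimately show ?thesis by simp
qed

lemma has_derivative_f_equilibrium:
  assumes e: "equilibrium a z"
  shows "(f a has_derivative flow_linearization a z) (at z)"
proof (rule has_derivative_vecI)
  fix i :: 3
  obtain j k where ix: "{i, j, k} = UNIV"
    using index3_succ by blast
  have z: "z \<in> metrics" "f a z = 0"
    using e by (auto simp: equilibrium_def)
  have pos: "z $ j > 0" "z $ k > 0"
    using z metrics_iff[OF ix] by auto
  define N where "N x = x $ i * (x $ j + x $ k) + 2 * a * (x $ j * x $ j + x $ k * x $ k - 2 * (x $ i * x $ i))" for x :: "real^3"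
  define M where "M x = x $ j * x $ k" for x :: "real^3"
  define N' where "N' v = v $ i * (z $ j + z $ k) + z $ i * (v $ j + v $ k)
      + 4 * a * (z $ j * v $ j + z $ k * v $ k - 2 * (z $ i * v $ i))" for v :: "real^3"
  define M' where "M' v = v $ j * z $ k + z $ j * v $ k" for v :: "real^3"
  have fNM: "N x / M x - 2 = f a x $ i" if "x \<in> metrics" for x
  proof -
    have "x $ j > 0" "x $ k > 0"
      using that metrics_iff[OF ix] by auto
    then show ?thesis
      unfolding f_eq[OF ix] N_def M_def by (simp add: field_simps power2_eq_square)
  qed
  have M: "M z > 0" and NM: "N z = 2 * M z"
    using fNM[OF z(1)] pos z(2) by (auto simp: M_def field_simps)
  note nth = bounded_linear_imp_has_derivative[OF bounded_linear_vec_nth]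
  have dN: "(N has_derivative N') (at z)"
    unfolding N_def N'_def by (auto intro!: derivative_eq_intros nth simp: algebra_simps)
  have dM: "(M has_derivative M') (at z)"
    unfolding M_def M'_def by (auto intro!: derivative_eq_intros nth simp: algebra_simps)
  have "((\<lambda>x. N x / M x - 2) has_derivative (\<lambda>v. (N' v * M z - N z * M' v) / (M z * M z) - 0)) (at z)"
    using M by (intro has_derivative_diff has_derivative_divide' dN dM has_derivative_const) simp
  moreover have "(N' v * M z - N z * M' v) / (M z * M z) - 0 = flow_linearization a z v $ i" for v
    unfolding NM flow_linearization_nth[OF ix] N'_def[symmetric] M'_def[symmetric] M_def[symmetric]
    using M by (simp add: field_simps)
  ultimately have "((\<lambda>x. N x / M x - 2) has_derivative (\<lambda>v. flow_linearization a z v $ i)) (at z)"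
    by simp
  then show "((\<lambda>x. f a x $ i) has_derivative (\<lambda>v. flow_linearization a z v $ i)) (at z)"
    by (rule has_derivative_transform_within_open[OF _ open_metrics z(1) fNM])
qed

text \<open>
  The equilibrium on \<open>l\<^sub>k\<close> is proportional to \<open>(1, 1, 2)\<close>. By the symmetry exchanging \<open>i\<close> and \<open>j\<close>,
  the antisymmetric and the symmetric tangent vector, \<open>(1, -1, 0)\<close> and \<open>(1, 1, -4)\<close>, are
  eigenvectors.
\<close>

lemma saddle_kaehler_point:
  assumes ix: "{i, j, k} = UNIV" and c: "c > 0" "c ^ 3 = 4"
  shows "saddle (1/6) (kaehler_point i k 0 c)" "kaehler_point i k 0 c \<in> l_curve k"
proof -
  let ?z = "kaehler_point i k 0 c"
  have ix2: "{j, i, k} = UNIV" "{k, i, j} = UNIV"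
    using ix by auto
  note n = kaehler_point_nth[OF ix]
  have d: "0\<^sup>2 = c\<^sup>2 - 4 / c"
    using c by (simp add: field_simps power2_eq_square power3_eq_cube)
  then show l: "?z \<in> l_curve k"
    using kaehler_point_l_curve_iff[OF ix c(1)] by blast
  then have v: "?z \<in> unit_vol"
    unfolding l_curve_eq[OF ix] by blast
  have "f (1/6) ?z = 0"
    unfolding f_kaehler_point[OF ix c(1) d] vec3_eq[OF ix] n using c by simp
  then have e: "equilibrium (1/6) ?z"
    using unit_vol_metrics[OF v] by (simp add: equilibrium_def)
  (* v1 is e_i - e_j, tangent to the curve; v2 is e_i + e_j - 4 e_k. *)
  define v1 where "v1 = kaehler_point i k 2 0"
  define v2 :: "real^3" where "v2 = (\<chi> m. if m = k then - 4 else 1)"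
  have n1: "v1 $ i = 1" "v1 $ j = - 1" "v1 $ k = 0"
    unfolding v1_def n by simp_all
  have n2: "v2 $ i = 1" "v2 $ j = 1" "v2 $ k = - 4"
    using index3_distinct[OF ix] by (auto simp: v2_def)
  have "flow_linearization (1/6) ?z v1 = (4 / c) *\<^sub>R v1"
    "flow_linearization (1/6) ?z v2 = (- 2 / c) *\<^sub>R v2"
    unfolding vec3_eq[OF ix] vector_scaleR_component flow_linearization_nth[OF ix]
      flow_linearization_nth[OF ix2(1)] flow_linearization_nth[OF ix2(2)] n n1 n2
    using c(1) by (simp_all add: field_simps)
  moreover have "v1 \<in> tangent_unit_vol ?z" "v2 \<in> tangent_unit_vol ?z"
    unfolding tangent_unit_vol_def mem_Collect_eq sum_index3[OF ix] n n1 n2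
    using c(1) by (simp_all add: field_simps)
  moreover have "v1 \<noteq> 0" "v2 \<noteq> 0"
    using n1(1) n2(1) by auto
  moreover have "- 2 / c < 0" "4 / c > 0"
    using c(1) by simp_all
  ultimately show "saddle (1/6) ?z"
    unfolding saddle_def using v e has_derivative_f_equilibrium[OF e] by blast
qed

text \<open>
  The equilibrium is the only point of \<open>l\<^sub>k\<close> with \<open>x\<^sub>i = x\<^sub>j\<close>; through every other point passes one
  of the orbits constructed above.
\<close>

lemma separatrix_l_curve:
  assumes ix: "{i, j, k} = UNIV"
  shows "\<exists>z. separatrix (1/6) z (l_curve k)"
proof -
  define c :: real where "c = 4 powr (1/3)"
  have c: "c > 0" "c ^ 3 = 4"
    by (simp_all add: c_def powr_power)
  have ix2: "{k, i, j} = UNIV"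
    using ix by auto
  let ?z = "kaehler_point i k 0 c"
  have "\<exists>J x. maximal_solution (1/6) J x \<and> y \<in> x ` J \<and> tends_in_time J x ?z"
    if y: "y \<in> l_curve k - {?z}" for y
  proof -
    have "y $ i \<noteq> y $ j"
    proof
      assume eq: "y $ i = y $ j"
      define v where "v = y $ k"
      have v: "v > 0"
        using y unfolding l_curve_eq[OF ix] unit_vol_iff[OF ix] v_def by simp
      have yk: "y = kaehler_point i k 0 v"
        using l_curve_eq_kaehler_point[OF ix, of y] y eq v_def by simp
      then have "0\<^sup>2 = v\<^sup>2 - 4 / v"
        using kaehler_point_l_curve_iff[OF ix v, of 0] y by blast
      then have "v ^ 3 = c ^ 3"
        unfolding c(2) using v by (simp add: field_simps power2_eq_square power3_eq_cube)
      then have "v = c"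
        using v c(1) power_eq_imp_eq_base[of v 3 c] by simp
      with yk y show False by blast
    qed
    with y show ?thesis
      using kaehler_orbit[OF ix c] by blast
  qed
  moreover have "l_curve k \<subseteq> unit_vol"
    unfolding l_curve_eq[OF ix] by blast
  moreover have "regular_open_curve (l_curve k)"
    unfolding l_curve_eq_l_param[OF ix2] by (rule regular_open_curve_l[OF ix2])
  ultimately have "separatrix (1/6) ?z (l_curve k)"
    unfolding separatrix_def using saddle_kaehler_point[OF ix c] invariant_l_curve[OF ix] by blast
  then show ?thesis ..
qed

theorem theorem2:
  fixes a :: real and i j k :: 3
  assumes "0 < a" "a < 1/2" and "{i, j, k} = UNIV"
  shows
    "(top_of_set unit_vol frontier_of unit_ricci_pos a = r_curve a 1 \<union> r_curve a 2 \<union> r_curve a 3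
      \<and> r_curve a k \<subseteq> unit_vol \<inter> Lambda a k
      \<and> r_curve a k = r_comp a k i \<union> r_comp a k j
      \<and> components (r_curve a k) = {r_comp a k i, r_comp a k j}
      \<and> r_comp a k i \<noteq> r_comp a k j
      \<and> regular_param (r_param a k i) {0<..a} \<and> regular_param (r_param a k j) {0<..a}
      \<and> (\<forall>t\<in>{0<..a}. t ^ 4 - t ^ 3 / a + t\<^sup>2 > 0 \<and> beta a t > 0))
    \<and>
     (r_curve a i \<inter> r_curve a j = {P_point a i j}
      \<and> P_point a i j \<in> r_comp a i j \<inter> r_comp a j i
      \<and> I_curve k \<inter> r_comp a i j = {P_point a i j}
      \<and> I_curve k \<inter> r_comp a j i = {P_point a i j}
      \<and> ((\<lambda>p. infdist (I_point k p) (r_comp a i k)) \<longlongrightarrow> 0) at_top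
      \<and> ((\<lambda>p. infdist (I_point k p) (r_comp a j k)) \<longlongrightarrow> 0) at_top)
    \<and>
     (\<forall>x\<in>unit_vol. equilibrium a x \<longrightarrow> x \<in> unit_ricci_pos a)
    \<and>
     (a = 1/6 \<longrightarrow>
        (\<exists>z. separatrix a z (l_curve k)) \<and> l_curve k = l_param k i ` {0<..})"
proof (intro conjI ballI impI)
  note a = assms(1,2) and ix = assms(3)
  have ix2: "{j, i, k} = UNIV" "{k, i, j} = UNIV" "{k, j, i} = UNIV"
    using ix by auto
  show "top_of_set unit_vol frontier_of unit_ricci_pos a = r_curve a 1 \<union> r_curve a 2 \<union> r_curve a 3"
    unfolding frontier_unit_ricci_pos[OF a] UNIV_3 by auto
  show "r_curve a k \<subseteq> unit_vol \<inter> Lambda a k"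
    using r_curve_iff[OF a] unit_vol_metrics by (auto simp: Lambda_def)
  show "r_curve a k = r_comp a k i \<union> r_comp a k j"
    by (rule r_curve_eq_Un[OF ix2(2)])
  show "components (r_curve a k) = {r_comp a k i, r_comp a k j}" "r_comp a k i \<noteq> r_comp a k j"
    by (rule components_r_curve[OF a ix2(2)])+
  show "regular_param (r_param a k i) {0<..a}" "regular_param (r_param a k j) {0<..a}"
    by (rule regular_param_r_param[OF a ix2(2)] regular_param_r_param[OF a ix2(3)])+
  show "t ^ 4 - t ^ 3 / a + t\<^sup>2 > 0" "beta a t > 0" if "t \<in> {0<..a}" for t
    using beta_poly_pos[OF a] beta_pos that by auto
  show "r_curve a i \<inter> r_curve a j = {P_point a i j}"
    by (rule r_curves_Int[OF a ix])
  show "P_point a i j \<in> r_comp a i j \<inter> r_comp a j i"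
    using P_point_in_r_comp[OF a ix] P_point_in_r_comp[OF a ix2(1)] P_point_commute[of a j i] by simp
  show "I_curve k \<inter> r_comp a i j = {P_point a i j}" "I_curve k \<inter> r_comp a j i = {P_point a i j}"
    using I_curve_Int_r_comp[OF a ix] I_curve_Int_r_comp[OF a ix2(1)] P_point_commute by metis+
  show "((\<lambda>p. infdist (I_point k p) (r_comp a i k)) \<longlongrightarrow> 0) at_top"
    "((\<lambda>p. infdist (I_point k p) (r_comp a j k)) \<longlongrightarrow> 0) at_top"
    by (rule infdist_I_r_comp[OF a ix] infdist_I_r_comp[OF a ix2(1)])+
  show "x \<in> unit_ricci_pos a" if "x \<in> unit_vol" "equilibrium a x" for x
    by (rule equilibrium_in_unit_ricci_pos[OF a that])
  show "\<exists>z. separatrix a z (l_curve k)" if "a = 1/6"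
    unfolding that by (rule separatrix_l_curve[OF ix])
  show "l_curve k = l_param k i ` {0<..}"
    by (rule l_curve_eq_l_param[OF ix2(2)])
qed

end
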